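(* Let $c:\Omega\times\Omega\to\mathbb R$ be Lipschitz continuous, and let $\psi^+,\psi^-\in C(\partial\Omega)$ satisfy $\psi^-(y)-\psi^+(x)\le c(x,y)$ for all $x,y\in\partial\Omega$. Then the infimum $$\mathcal T_1(\mu^\pm;\psi^\pm)=\inf\Big\{\int_{\Omega\times\Omega}c\,\mathrm d\pi+\int_{\partial\Omega}\psi^+\,\mathrm d\pi_x-\int_{\partial\Omega}\psi^-\,\mathrm d\pi_y:\pi\in\mathcal P_0(\mu^+,\mu^-)\Big\}$$ is attained, and the duality formula $\mathcal T_1(\mu^\pm;\psi^\pm)=\mathcal D_1(\mu^\pm;\psi^\pm)$ holds, where $$\mathcal D_1(\mu^\pm;\psi^\pm)=\sup\Big\{\int_\Omega\phi^-\,\mathrm d\mu^--\int_\Omega\phi^+\,\mathrm d\mu^+:\ \phi^\pm\in C(\Omega),\ \psi^-\le\phi^-\le\phi^+\le\psi^+\text{ on }\partial\Omega,\ \phi^-(y)-\phi^+(x)\le c(x,y)\ \forall x,y\in\Omega\Big\}.$$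
   Context: $\Omega\subset\mathbb R^d$ is a compact domain with interior $\Omega^\circ$ and boundary $\partial\Omega\subset\Omega$. $\mu^+,\mu^-$ are finite positive Borel measures on $\Omega^\circ$, regarded as measures on $\Omega$ giving no mass to $\partial\Omega$ (their total masses may differ). $\mathcal M^+(\Omega\times\Omega)$ is the set of finite positive Borel measures on $\Omega\times\Omega$, $\pi_x,\pi_y$ are the first and second marginals of $\pi$, and $\mathcal P_0(\mu^+,\mu^-)=\{\pi\in\mathcal M^+(\Omega\times\Omega):(\pi_x)_{|\Omega^\circ}=\mu^+,\ (\pi_y)_{|\Omega^\circ}=\mu^-\}$.
   Formalization: The duality formula (not attainment) is stated under the added assumption ψ^- ≤ ψ^+ on ∂Ω; where this fails no φ^± is admissible, so D_1 = -∞ while T_1 is finite (e.g. Ω=[0,1], c=1, ψ^-=1, ψ^+=0). *)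

theory Defs
  imports "HOL-Analysis.Analysis"
begin

text \<open>
  A finite Borel measure on a subset \<open>S\<close> is a measure whose space is \<open>S\<close> itself,
  with the trace of the Borel sets as its sigma-algebra.
\<close>

definition finite_borel_measures :: "'a::topological_space set \<Rightarrow> 'a measure set" where
  "finite_borel_measures S =
     {M. sets M = sets (restrict_space borel S) \<and> finite_measure M}"

definition marginal_x :: "'a::euclidean_space set \<Rightarrow> ('a \<times> 'a) measure \<Rightarrow> 'a measure" where
  "marginal_x \<Omega> \<pi> = distr \<pi> (restrict_space borel \<Omega>) fst"

definition marginal_y :: "'a::euclidean_space set \<Rightarrow> ('a \<times> 'a) measure \<Rightarrow> 'a measure" where
  "marginal_y \<Omega> \<pi> = distr \<pi> (restrict_space borel \<Omega>) snd"

text \<open>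
  The measures \<open>\<mu>p\<close>, \<open>\<mu>m\<close> live on \<open>\<Omega>\<close>, hence they are restricted to the interior as well.
  The marginals are unconstrained on \<open>frontier \<Omega>\<close>.
\<close>

definition plans :: "'a::euclidean_space set \<Rightarrow> 'a measure \<Rightarrow> 'a measure
    \<Rightarrow> ('a \<times> 'a) measure set" where
  "plans \<Omega> \<mu>p \<mu>m =
     {\<pi> \<in> finite_borel_measures (\<Omega> \<times> \<Omega>).
        restrict_space (marginal_x \<Omega> \<pi>) (interior \<Omega>) = restrict_space \<mu>p (interior \<Omega>) \<and>
        restrict_space (marginal_y \<Omega> \<pi>) (interior \<Omega>) = restrict_space \<mu>m (interior \<Omega>)}"

definition transport_cost :: "'a::euclidean_space set \<Rightarrow> ('a \<times> 'a \<Rightarrow> real)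
    \<Rightarrow> ('a \<Rightarrow> real) \<Rightarrow> ('a \<Rightarrow> real) \<Rightarrow> ('a \<times> 'a) measure \<Rightarrow> real" where
  "transport_cost \<Omega> c \<psi>p \<psi>m \<pi> =
     (LINT z|\<pi>. c z)
     + (LINT x:frontier \<Omega>|marginal_x \<Omega> \<pi>. \<psi>p x)
     - (LINT y:frontier \<Omega>|marginal_y \<Omega> \<pi>. \<psi>m y)"

text \<open>
  The two optimal values are extended reals, so that infima and suprema always have their
  usual meaning; in particular the supremum over an empty set of potentials is \<open>-\<infinity>\<close>.
\<close>

definition primal_value :: "'a::euclidean_space set \<Rightarrow> ('a \<times> 'a \<Rightarrow> real)
    \<Rightarrow> 'a measure \<Rightarrow> 'a measure \<Rightarrow> ('a \<Rightarrow> real) \<Rightarrow> ('a \<Rightarrow> real) \<Rightarrow> ereal" where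
  "primal_value \<Omega> c \<mu>p \<mu>m \<psi>p \<psi>m =
     (INF \<pi>\<in>plans \<Omega> \<mu>p \<mu>m. ereal (transport_cost \<Omega> c \<psi>p \<psi>m \<pi>))"

definition potentials :: "'a::euclidean_space set \<Rightarrow> ('a \<times> 'a \<Rightarrow> real)
    \<Rightarrow> ('a \<Rightarrow> real) \<Rightarrow> ('a \<Rightarrow> real) \<Rightarrow> (('a \<Rightarrow> real) \<times> ('a \<Rightarrow> real)) set" where
  "potentials \<Omega> c \<psi>p \<psi>m =
     {(\<phi>p, \<phi>m).
        continuous_on \<Omega> \<phi>p \<and> continuous_on \<Omega> \<phi>m \<and>
        (\<forall>x\<in>frontier \<Omega>. \<psi>m x \<le> \<phi>m x \<and> \<phi>m x \<le> \<phi>p x \<and> \<phi>p x \<le> \<psi>p x) \<and>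
        (\<forall>x\<in>\<Omega>. \<forall>y\<in>\<Omega>. \<phi>m y - \<phi>p x \<le> c (x, y))}"

definition dual_value :: "'a::euclidean_space set \<Rightarrow> ('a \<times> 'a \<Rightarrow> real)
    \<Rightarrow> 'a measure \<Rightarrow> 'a measure \<Rightarrow> ('a \<Rightarrow> real) \<Rightarrow> ('a \<Rightarrow> real) \<Rightarrow> ereal" where
  "dual_value \<Omega> c \<mu>p \<mu>m \<psi>p \<psi>m =
     (SUP (\<phi>p, \<phi>m)\<in>potentials \<Omega> c \<psi>p \<psi>m.
        ereal ((LINT y|\<mu>m. \<phi>m y) - (LINT x|\<mu>p. \<phi>p x)))"

end

theory Submission
  imports Defs "HOL-Probability.Helly_Selection" "HOL-Probability.Giry_Monad"
begin

text \<open>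
  Extend \<open>\<psi>\<^sup>+\<close> and \<open>\<psi>\<^sup>-\<close> continuously to \<open>\<Omega>\<close>. Up to a constant the cost of a plan \<open>\<pi>\<close> is then the integral of
  \<open>C(x,y) = c(x,y) + \<psi>\<^sup>+(x) - \<psi>\<^sup>-(y)\<close>, which is nonnegative on pairs of boundary points. Hence mass on such
  pairs may be discarded, the remaining mass is bounded by that of \<open>\<mu>\<^sup>+\<close> and \<open>\<mu>\<^sup>-\<close>, and weak compactness
  gives a minimiser.

  For the duality, replace \<open>C\<close> by \<open>C + \<delta>\<close> and the marginal constraints by quadratic penalties against
  countably many test functions vanishing on the boundary. The first order conditions at the penalised minimisers
  produce potentials that are admissible up to \<open>\<delta>\<close>, agree with \<open>\<psi>\<^sup>+\<close> and \<open>\<psi>\<^sup>-\<close> on the boundary, and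
  are nearly optimal; no separation theorem is needed. A truncation by c-transforms, which are continuous since
  \<open>c\<close> is Lipschitz, makes them admissible at a cost of order \<open>\<delta>\<close>.
\<close>

section \<open>Sums of measures\<close>

text \<open>Mass on pairs of boundary points can be added to a plan freely, so plans have no common
  mass bound. Compactness needs a cap \<open>M\<close>, and the cap must be inactive at the
  minimiser: otherwise no atom may be added there, and the cap would bring a multiplier of its own
  into the dual. This is what \<delta> buys. Boundary pairs then cost at least \<delta> > 0, so a
  minimiser avoids them and its mass is at most the total mass of \<open>\<mu>p\<close> and
  \<open>\<mu>m\<close>. The price is that the potentials satisfy their inequality only with
  \<open>c + \<delta>\<close>. Lowering \<open>\<phi>m\<close> by \<delta> everywhere would repair
  it but would break \<open>\<psi>m \<le> \<phi>m\<close> on the boundary; hence the truncation. The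
  test functions vanish on the boundary because the marginals are free there. Finite combinations of
  them vanish there too, which is why the boundary values of the potentials come out exact and not
  only up to an error. Weak compactness is obtained on the real line and carried to compact sets by
  a coding that is only measurable but has a continuous inverse.\<close>

definition add_measure :: "'a measure \<Rightarrow> 'a measure \<Rightarrow> 'a measure" where
  "add_measure A B = measure_of (space A) (sets A) (\<lambda>X. emeasure A X + emeasure B X)"

lemma sets_add_measure [simp, measurable_cong]: "sets (add_measure A B) = sets A"
  and space_add_measure [simp]: "space (add_measure A B) = space A"
  by (auto simp: add_measure_def)

lemma emeasure_add_measure:
  assumes "sets A = sets B" "X \<in> sets A"
  shows "emeasure (add_measure A B) X = emeasure A X + emeasure B X"
  unfolding add_measure_def
proof (rule emeasure_measure_of_sigma)
  show "countably_additive (sets A) (\<lambda>X. emeasure A X + emeasure B X)"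
    using assms by (auto simp: countably_additive_def suminf_add[symmetric] suminf_emeasure)
qed (use assms(2) sets.sigma_algebra_axioms[of A] in \<open>auto simp: positive_def\<close>)

lemma finite_measure_add_measure:
  assumes "sets A = sets B" "finite_measure A" "finite_measure B"
  shows "finite_measure (add_measure A B)"
proof -
  interpret A: finite_measure A by fact
  interpret B: finite_measure B by fact
  have "space B = space A" using assms(1) by (metis sets_eq_imp_space_eq)
  then show ?thesis
    using emeasure_add_measure[OF assms(1) sets.top]
    by (intro finite_measureI) (simp add: A.emeasure_eq_measure B.emeasure_eq_measure)
qed

lemma nn_integral_add_measure:
  assumes s: "sets A = sets B" and f: "f \<in> borel_measurable A"
  shows "(\<integral>\<^sup>+x. f x \<partial>add_measure A B) = (\<integral>\<^sup>+x. f x \<partial>A) + (\<integral>\<^sup>+x. f x \<partial>B)"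
  using f
proof (induction rule: borel_measurable_induct)
  case (cong f g)
  have "space B = space A" using s by (metis sets_eq_imp_space_eq)
  then show ?case
    using cong by (simp cong: nn_integral_cong_simp)
next
  case (set X)
  then show ?case using s by (simp add: emeasure_add_measure)
next
  case (mult u c)
  moreover have "u \<in> borel_measurable B"
    using mult s by (simp cong: measurable_cong_sets)
  moreover have "u \<in> borel_measurable (add_measure A B)"
    using mult by (simp cong: measurable_cong_sets)
  ultimately show ?case by (simp add: nn_integral_cmult distrib_left)
next
  case (add u v)
  moreover have "u \<in> borel_measurable B" "v \<in> borel_measurable B"
    using add s by (simp_all cong: measurable_cong_sets)
  moreover have "u \<in> borel_measurable (add_measure A B)" "v \<in> borel_measurable (add_measure A B)"
    using add by (simp_all cong: measurable_cong_sets)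
  ultimately show ?case by (simp add: nn_integral_add ac_simps)
next
  case (seq U)
  have m: "U i \<in> borel_measurable B" "U i \<in> borel_measurable (add_measure A B)" for i
    using seq s by (simp_all cong: measurable_cong_sets)
  have inc: "incseq (\<lambda>i. \<integral>\<^sup>+x. U i x \<partial>M)" for M
    using seq by (auto simp: mono_def le_fun_def intro!: nn_integral_mono)
  show ?case
    using seq m inc by (simp add: image_comp nn_integral_monotone_convergence_SUP ennreal_SUP_add)
qed

lemma integral_add_measure:
  fixes f :: "'a \<Rightarrow> real"
  assumes s: "sets A = sets B" and f: "integrable A f" "integrable B f"
  shows "integral\<^sup>L (add_measure A B) f = integral\<^sup>L A f + integral\<^sup>L B f"
proof -
  have m: "f \<in> borel_measurable A" "f \<in> borel_measurable (add_measure A B)"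
    using f by (simp_all cong: measurable_cong_sets)
  have int: "integrable (add_measure A B) f"
    using f m s by (simp add: integrable_iff_bounded nn_integral_add_measure)
  \<comment> \<open>\<open>enn2real\<close> is additive only on finite values, so the positive and
    negative parts must have finite integrals under both measures.\<close>
  have fin: "integral\<^sup>N A (\<lambda>x. ennreal (g x)) < top" "integral\<^sup>N B (\<lambda>x. ennreal (g x)) < top"
    if "\<And>x. g x \<le> norm (f x)" for g
  proof -
    have "integral\<^sup>N A (\<lambda>x. ennreal (g x)) \<le> integral\<^sup>N A (\<lambda>x. ennreal (norm (f x)))"
      "integral\<^sup>N B (\<lambda>x. ennreal (g x)) \<le> integral\<^sup>N B (\<lambda>x. ennreal (norm (f x)))"
      using that by (auto intro!: nn_integral_mono ennreal_leI simp del: real_norm_def)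
    then show "integral\<^sup>N A (\<lambda>x. ennreal (g x)) < top" "integral\<^sup>N B (\<lambda>x. ennreal (g x)) < top"
      using f unfolding integrable_iff_bounded by (auto intro: le_less_trans)
  qed
  have "integral\<^sup>N A (\<lambda>x. ennreal (f x)) < top" "integral\<^sup>N B (\<lambda>x. ennreal (f x)) < top"
    "integral\<^sup>N A (\<lambda>x. ennreal (- f x)) < top" "integral\<^sup>N B (\<lambda>x. ennreal (- f x)) < top"
    by (rule fin, simp)+
  then show ?thesis
    using f m s int
    by (simp add: real_lebesgue_integral_def nn_integral_add_measure enn2real_plus)
qed

section \<open>Finite Borel measures on compact sets\<close>

lemma fbmD:
  assumes "\<pi> \<in> finite_borel_measures K"
  shows "sets \<pi> = sets (restrict_space borel K)" "space \<pi> = K" "finite_measure \<pi>"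
  using assms sets_eq_imp_space_eq[of \<pi> "restrict_space borel K"]
  by (auto simp: finite_borel_measures_def space_restrict_space)

lemma fbm_borel_measurable:
  assumes "\<pi> \<in> finite_borel_measures K" "continuous_on K f"
  shows "f \<in> borel_measurable \<pi>"
  using borel_measurable_continuous_on_restrict[OF assms(2)] fbmD(1)[OF assms(1)]
  by (simp cong: measurable_cong_sets)

lemma fbm_integrable:
  fixes f :: "'b::topological_space \<Rightarrow> real"
  assumes "compact K" "\<pi> \<in> finite_borel_measures K" "continuous_on K f"
  shows "integrable \<pi> f"
proof -
  interpret finite_measure \<pi> using assms by (auto intro: fbmD)
  have "bounded (f ` K)"
    using assms by (intro compact_imp_bounded compact_continuous_image)
  then obtain B where "\<And>x. x \<in> K \<Longrightarrow> norm (f x) \<le> B"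
    by (auto simp: bounded_iff)
  then show ?thesis
    using fbmD[OF assms(2)] fbm_borel_measurable[OF assms(2,3)]
    by (intro integrable_const_bound[of _ B]) auto
qed

section \<open>Perturbations of a measure: scaling, sums and atoms\<close>

lemma integral_const_density:
  fixes f :: "'b \<Rightarrow> real"
  assumes "f \<in> borel_measurable M" "0 \<le> c"
  shows "integral\<^sup>L (density M (\<lambda>_. ennreal c)) f = c * integral\<^sup>L M f"
  using assms integral_real_density[of "\<lambda>_. c" M f] by simp

lemma fbm_density_const:
  assumes "\<pi> \<in> finite_borel_measures K"
  shows "density \<pi> (\<lambda>_. ennreal c) \<in> finite_borel_measures K"
proof -
  interpret finite_measure \<pi> using assms by (auto intro: fbmD)
  show ?thesis
    using fbmD[OF assms]
    by (auto simp: finite_borel_measures_def emeasure_density_const emeasure_eq_measure ennreal_mult_eq_top_iff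
        intro!: finite_measureI)
qed

lemma fbm_add_measure:
  assumes "\<pi> \<in> finite_borel_measures K" "\<rho> \<in> finite_borel_measures K"
  shows "add_measure \<pi> \<rho> \<in> finite_borel_measures K"
  using fbmD[OF assms(1)] fbmD[OF assms(2)] finite_measure_add_measure[of \<pi> \<rho>]
  by (simp add: finite_borel_measures_def)

lemma fbm_return:
  assumes "z \<in> K"
  shows "return (restrict_space borel K) z \<in> finite_borel_measures K"
proof -
  interpret prob_space "return (restrict_space borel K) z"
    using assms by (intro prob_space_return) (simp add: space_restrict_space)
  show ?thesis by (simp add: finite_borel_measures_def finite_measure_axioms)
qed

text \<open>The variation used for pointwise dual feasibility: an atom of mass \<open>t\<close>
  moves every continuous integral linearly in \<open>t\<close>. The case \<open>f = 1\<close>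
  controls the mass.\<close>

lemma integral_fbm_add_atom:
  fixes f :: "'b::topological_space \<Rightarrow> real"
  assumes "compact K" "\<pi> \<in> finite_borel_measures K" "z \<in> K" "0 \<le> t" "continuous_on K f"
  defines "\<rho> \<equiv> add_measure \<pi> (density (return (restrict_space borel K) z) (\<lambda>_. ennreal t))"
  shows "\<rho> \<in> finite_borel_measures K"
    and "integral\<^sup>L \<rho> f = integral\<^sup>L \<pi> f + t * f z"
proof -
  have f: "f \<in> borel_measurable (return (restrict_space borel K) z)"
    by (rule fbm_borel_measurable[OF fbm_return assms(5)]) fact
  have z: "integral\<^sup>L (return (restrict_space borel K) z) f = f z"
    using f assms by (intro integral_return) (auto simp: space_restrict_space cong: measurable_cong_sets)
  have d: "density (return (restrict_space borel K) z) (\<lambda>_. ennreal t) \<in> finite_borel_measures K"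
    by (intro fbm_density_const fbm_return assms)
  show "\<rho> \<in> finite_borel_measures K"
    unfolding \<rho>_def by (intro fbm_add_measure d assms)
  show "integral\<^sup>L \<rho> f = integral\<^sup>L \<pi> f + t * f z"
    unfolding \<rho>_def using fbmD(1)[OF assms(2)] fbmD(1)[OF d] f z assms d
    by (subst integral_add_measure) (auto simp: integral_const_density intro!: fbm_integrable)
qed

section \<open>Weak compactness\<close>

text \<open>
  The code of a point lists its memberships in a countable family of balls as ternary digits 0 and 1.
  Base 3 separates codes that differ in an early digit, so decoding is uniformly continuous and
  extends to the whole line.
\<close>

lemma compact_real_coding:
  fixes K :: "'b::euclidean_space set"
  assumes "compact K"
  obtains s :: "'b \<Rightarrow> real" and G :: "real \<Rightarrow> 'b"
  where "s \<in> borel_measurable borel" "\<And>x. 0 \<le> s x" "\<And>x. s x \<le> 2"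
    "continuous_on UNIV G" "\<And>x. x \<in> K \<Longrightarrow> G (s x) = x"
proof -
  obtain D :: "'b set" where D: "countable D" "\<And>X. open X \<Longrightarrow> X \<noteq> {} \<Longrightarrow> \<exists>d\<in>D. d \<in> X"
    using countable_dense_setE by blast
  define \<U> where "\<U> = (\<lambda>(d, n). ball d (1 / Suc n)) ` (D \<times> (UNIV::nat set))"
  have c\<U>: "countable \<U>" "\<U> \<noteq> {}"
    using D(1) D(2)[of UNIV] by (auto simp: \<U>_def)
  define U where "U = from_nat_into \<U>"
  have rU: "range U = \<U>"
    using c\<U> by (simp add: U_def range_from_nat_into)
  have oU: "open (U k)" for k
  proof -
    have "U k \<in> \<U>" using rU by auto
    then show ?thesis by (auto simp: \<U>_def)
  qed
  define i where "i k x = (indicator (U k) x :: real)" for k x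
  have i01: "0 \<le> i k x" "i k x \<le> 1" for k x
    by (auto simp: i_def indicator_def)
  define s where "s x = (\<Sum>k. i k x * (1/3) ^ k)" for x
  have g: "summable (\<lambda>k. (1/3::real) ^ k)"
    by (simp add: summable_geometric)
  have sm: "summable (\<lambda>k. i k x * (1/3) ^ k)" for x
    by (rule summable_comparison_test'[OF g, of 0]) (auto simp: i01 abs_mult intro: mult_left_le_one_le)
  have s_meas: "s \<in> borel_measurable borel"
  proof -
    have [measurable]: "U k \<in> sets borel" for k using oU by auto
    show ?thesis unfolding s_def i_def by measurable
  qed
  have s0: "0 \<le> s x" for x
    unfolding s_def using sm i01 by (intro suminf_nonneg) auto
  have s2: "s x \<le> 2" for x
  proof -
    have "s x \<le> (\<Sum>k. (1/3::real) ^ k)"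
      unfolding s_def using sm g i01 by (intro suminf_le) (auto intro: mult_left_le_one_le)
    also have "\<dots> = 3/2" by (subst suminf_geometric) auto
    finally show ?thesis by simp
  qed
  \<comment> \<open>At the first differing digit \<open>m\<close> the two series differ by
    \<open>(1/3) ^ m\<close>, and everything after it sums to at most half of that. So the codes are
    at least \<open>(1/3) ^ m / 2\<close> apart. In base 2 the tail could cancel the leading
    term.\<close>
  have agree: "k \<le> n \<Longrightarrow> i k x = i k y" if "dist (s x) (s y) < (1/3) ^ n / 2" for n x y k
  proof (rule ccontr)
    assume "k \<le> n" and ne: "i k x \<noteq> i k y"
    define m where "m = (LEAST k. i k x \<noteq> i k y)"
    have m: "i m x \<noteq> i m y" "m \<le> n" "\<And>j. j < m \<Longrightarrow> i j x = i j y"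
      using LeastI[of "\<lambda>k. i k x \<noteq> i k y", OF ne] Least_le[of "\<lambda>k. i k x \<noteq> i k y", OF ne]
        not_less_Least[of _ "\<lambda>k. i k x \<noteq> i k y"] \<open>k \<le> n\<close> unfolding m_def[symmetric] by (blast, linarith, blast)
    define d where "d j = (i j x - i j y) * (1/3) ^ j" for j
    have sd: "summable d" and sxy: "s x - s y = suminf d"
      unfolding d_def s_def using sm by (simp_all add: left_diff_distrib suminf_diff summable_diff)
    have ad: "\<bar>d j\<bar> \<le> (1/3) ^ j" for j
      using i01[of j x] i01[of j y] by (auto simp: d_def abs_mult intro!: mult_left_le_one_le)
    have "suminf d = (\<Sum>j. d (j + Suc m)) + (\<Sum>j<Suc m. d j)"
      by (rule suminf_split_initial_segment[OF sd])
    also have "(\<Sum>j<Suc m. d j) = d m"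
      using m(3) by (auto simp: d_def)
    finally have e: "s x - s y = (\<Sum>j. d (j + Suc m)) + d m" using sxy by simp
    have g': "summable (\<lambda>j. (1/3::real) ^ (j + Suc m))"
      using g by (rule summable_ignore_initial_segment)
    have "\<bar>\<Sum>j. d (j + Suc m)\<bar> \<le> (\<Sum>j. (1/3::real) ^ (j + Suc m))"
    proof -
      have sa: "summable (\<lambda>j. \<bar>d (j + Suc m)\<bar>)"
        by (rule summable_comparison_test'[OF g', of 0]) (simp only: real_norm_def abs_abs ad)
      have "\<bar>\<Sum>j. d (j + Suc m)\<bar> \<le> (\<Sum>j. \<bar>d (j + Suc m)\<bar>)"
        by (rule summable_rabs[OF sa])
      also have "\<dots> \<le> (\<Sum>j. (1/3::real) ^ (j + Suc m))"
        by (intro suminf_le ad sa g')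
      finally show ?thesis .
    qed
    also have "\<dots> = (\<Sum>j. (1/3::real) ^ j) * (1/3) ^ Suc m"
      unfolding power_add by (rule suminf_mult2[OF g, symmetric])
    also have "\<dots> = (1/3) ^ m / 2" by (subst suminf_geometric) auto
    finally have A: "\<bar>\<Sum>j. d (j + Suc m)\<bar> \<le> (1/3) ^ m / 2" .
    have B: "\<bar>d m\<bar> = (1/3) ^ m"
      using m(1) by (auto simp: d_def i_def indicator_def abs_mult split: if_splits)
    have C: "(1/3::real) ^ n \<le> (1/3) ^ m"
      using m(2) by (intro power_decreasing) auto
    show False
      using that A B C unfolding dist_real_def e by linarith
  qed
  \<comment> \<open>Finitely many balls of radius below \<open>e / 2\<close> cover \<open>K\<close>;
    let \<open>n\<close> bound their indices. Codes that agree up to digit \<open>n\<close> put both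
    points into a common ball.\<close>
  have close: "\<exists>\<delta>>0. \<forall>x\<in>K. \<forall>y\<in>K. dist (s x) (s y) < \<delta> \<longrightarrow> dist x y < e" if "e > 0" for e
  proof -
    obtain p :: nat where p: "1 / Suc p < e / 2"
      using \<open>e > 0\<close> nat_approx_posE[of "e/2"] by auto
    have "K \<subseteq> \<Union>((\<lambda>d. ball d (1 / Suc p)) ` D)"
    proof
      fix x assume "x \<in> K"
      obtain d where "d \<in> D" "d \<in> ball x (1 / Suc p)"
        using D(2)[of "ball x (1 / Suc p)"] by auto
      then show "x \<in> \<Union>((\<lambda>d. ball d (1 / Suc p)) ` D)"
        by (auto simp: dist_commute)
    qed
    then obtain T where T: "T \<subseteq> (\<lambda>d. ball d (1 / Suc p)) ` D" "finite T" "K \<subseteq> \<Union>T"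
      using compactE[OF assms, of "(\<lambda>d. ball d (1 / Suc p)) ` D"] by (metis imageE open_ball)
    have "T \<subseteq> range U"
      using T(1) unfolding rU \<U>_def by auto
    then obtain I where I: "finite I" "T = U ` I"
      using T(2) finite_subset_image by metis
    obtain n where n: "\<And>k. k \<in> I \<Longrightarrow> k \<le> n"
      using I(1) by (meson finite_nat_set_iff_bounded_le)
    show ?thesis
    proof (intro exI conjI ballI impI)
      fix x y assume xy: "x \<in> K" "y \<in> K" "dist (s x) (s y) < (1/3) ^ n / 2"
      obtain k where k: "k \<in> I" "x \<in> U k" using T I xy by auto
      have "i k x = i k y" using agree[OF xy(3)] n k by auto
      then have y: "y \<in> U k" using k by (auto simp: i_def indicator_def split: if_splits)
      obtain d where d: "U k = ball d (1 / Suc p)" using T I k by auto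
      have "dist x y \<le> dist x d + dist d y" by (rule dist_triangle)
      also have "\<dots> < e" using p k y unfolding d by (auto simp: dist_commute)
      finally show "dist x y < e" .
    qed simp
  qed
  have inj: "inj_on s K"
  proof (rule inj_onI, rule ccontr)
    fix x y assume xy: "x \<in> K" "y \<in> K" "s x = s y" "x \<noteq> y"
    then obtain \<delta> where "\<delta> > 0" "\<forall>x'\<in>K. \<forall>y'\<in>K. dist (s x') (s y') < \<delta> \<longrightarrow> dist x' y' < dist x y"
      using close[of "dist x y"] by auto
    then have "dist x y < dist x y" using xy by (metis dist_self)
    then show False by simp
  qed
  define g where "g = the_inv_into K s"
  have gs: "g (s x) = x" if "x \<in> K" for x
    using that inj by (simp add: g_def the_inv_into_f_f)
  have "uniformly_continuous_on (s ` K) g"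
    unfolding uniformly_continuous_on_def
  proof (intro allI impI)
    fix e :: real assume "e > 0"
    then obtain \<delta> where "\<delta> > 0" "\<And>x y. x \<in> K \<Longrightarrow> y \<in> K \<Longrightarrow> dist (s x) (s y) < \<delta> \<Longrightarrow> dist x y < e"
      using close by blast
    then show "\<exists>d>0. \<forall>x\<in>s ` K. \<forall>x'\<in>s ` K. dist x' x < d \<longrightarrow> dist (g x') (g x) < e"
      by (auto simp: gs)
  qed
  \<comment> \<open>Since \<open>s\<close> is only measurable, its image of \<open>K\<close> need
    not be closed. Uniform continuity extends the inverse to the closure, and Dugundji's theorem
    extends it from there to the line.\<close>
  then obtain h where h: "uniformly_continuous_on (closure (s ` K)) h" "\<And>t. t \<in> s ` K \<Longrightarrow> g t = h t"
    by (rule uniformly_continuous_on_extension_on_closure) metis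
  obtain G :: "real \<Rightarrow> 'b" where G: "continuous_on UNIV G" "\<And>t. t \<in> closure (s ` K) \<Longrightarrow> G t = h t"
  proof (rule Dugundji[of "UNIV::'b set" UNIV "closure (s ` K)" h])
    show "continuous_on (closure (s ` K)) h"
      using h(1) by (rule uniformly_continuous_imp_continuous)
  qed auto
  have "G (s x) = x" if "x \<in> K" for x
    using that G(2)[of "s x"] h(2)[of "s x"] gs[of x] closure_subset[of "s ` K"] by auto
  then show thesis
    by (rule that[OF s_meas s0 s2 G(1)])
qed

text \<open>
  Helly's theorem is applied to the images under a coding. The atom at \<open>-1\<close> tops up the mass,
  so that all measures become probability measures; the cutoff \<open>\<tau>\<close> removes it from the limit.
\<close>

lemma fbm_weak_compactness:
  fixes K :: "'b::euclidean_space set"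
  assumes K: "compact K" "K \<noteq> {}"
    and \<pi>: "\<And>n::nat. \<pi> n \<in> finite_borel_measures K" "\<And>n. measure (\<pi> n) K \<le> M"
  obtains r :: "nat \<Rightarrow> nat" and P where "strict_mono r" "P \<in> finite_borel_measures K" "measure P K \<le> M"
    "\<And>f :: 'b \<Rightarrow> real. continuous_on K f \<Longrightarrow> (\<lambda>n. integral\<^sup>L (\<pi> (r n)) f) \<longlonglongrightarrow> integral\<^sup>L P f"
proof -
  have cK: "closed K" using K compact_imp_closed by blast
  then have [measurable]: "K \<in> sets borel" by (rule borel_closed)
  interpret \<pi>: finite_measure "\<pi> n" for n using \<pi>(1) by (rule fbmD)
  obtain s :: "'b \<Rightarrow> real" and G where sG: "s \<in> borel_measurable borel" "\<And>x. 0 \<le> s x" "\<And>x. s x \<le> 2"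
    "continuous_on UNIV G" "\<And>x. x \<in> K \<Longrightarrow> G (s x) = x"
    by (rule compact_real_coding[OF K(1)]) (rule that)
  have s\<pi>[measurable]: "s \<in> borel_measurable (\<pi> n)" for n
    using measurable_restrict_space1[OF sG(1), of K] fbmD(1)[OF \<pi>(1)[of n]]
    by (simp cong: measurable_cong_sets)
  have sp: "space (\<pi> n) = K" for n using \<pi>(1) by (rule fbmD)
  \<comment> \<open>Strictly positive also for \<open>M = 0\<close>, so that division by
    \<open>B\<close> can normalise the measures.\<close>
  define B where "B = \<bar>M\<bar> + 1"
  have B: "B > 0" and mB: "measure (\<pi> n) K \<le> B" for n
    using \<pi>(2)[of n] by (auto simp: B_def)
  define \<nu> where "\<nu> n = density (add_measure (distr (\<pi> n) borel s)
      (density (return borel (-1)) (\<lambda>_. ennreal (B - measure (\<pi> n) K)))) (\<lambda>_. ennreal (1 / B))" for n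
  have sets\<nu>: "sets (\<nu> n) = sets borel" for n by (simp add: \<nu>_def)
  \<comment> \<open>All codes lie in \<open>{0..2}\<close> and the added atom sits at -1. The case
    \<open>A = UNIV\<close> gives total mass 1, and \<open>{-2<..2}\<close> gives tightness.\<close>
  have one: "emeasure (\<nu> n) A = 1" if A: "A \<in> sets borel" "-1 \<in> A" "{0..2} \<subseteq> A" for n A
  proof -
    have "s -` A \<inter> space (\<pi> n) = K" using A sG(2,3) sp by (fastforce simp: subset_iff)
    then have "emeasure (\<nu> n) A = ennreal (1 / B) * (ennreal (measure (\<pi> n) K) + ennreal (B - measure (\<pi> n) K) * 1)"
      using A by (simp add: \<nu>_def emeasure_density_const emeasure_add_measure emeasure_distr \<pi>.emeasure_eq_measure)
    also have "\<dots> = ennreal (1 / B) * ennreal B"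
      using mB[of n] by (simp flip: ennreal_plus)
    also have "\<dots> = 1" using B by (simp flip: ennreal_mult)
    finally show ?thesis .
  qed
  have rd: "real_distribution (\<nu> n)" for n
  proof -
    have "space (\<nu> n) = UNIV" using sets_eq_imp_space_eq[OF sets\<nu>[of n]] by simp
    then have "prob_space (\<nu> n)" using one[of UNIV n] by (intro prob_spaceI) simp
    then show ?thesis
      using sets\<nu> by (simp add: real_distribution_def real_distribution_axioms_def)
  qed
  have "tight \<nu>"
    unfolding tight_def
  proof (intro conjI allI impI rd)
    fix \<epsilon> :: real assume "\<epsilon> > 0"
    have "measure (\<nu> n) {-2<..2} = 1" for n
    proof -
      have "emeasure (\<nu> n) {-2<..2} = 1" by (rule one) auto
      then show ?thesis by (simp add: measure_def)
    qed
    then show "\<exists>a b. a < b \<and> (\<forall>n. measure (\<nu> n) {a<..b} > 1 - \<epsilon>)"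
      using \<open>\<epsilon> > 0\<close> by (intro exI[of _ "-2"] exI[of _ 2]) auto
  qed
  from tight_imp_convergent_subsubsequence[OF this strict_mono_id]
  obtain r N where r: "strict_mono r" and N: "real_distribution N" "weak_conv_m (\<nu> \<circ> r) N"
    by auto
  interpret N: real_distribution N by fact
  define \<tau> :: "real \<Rightarrow> real" where "\<tau> t = max 0 (min 1 (t + 1))" for t
  have \<tau>: "0 \<le> \<tau> t" "\<tau> t \<le> 1" "\<tau> (-1) = 0" "t \<ge> 0 \<Longrightarrow> \<tau> t = 1" "continuous_on UNIV \<tau>" for t
    by (auto simp: \<tau>_def intro!: continuous_intros)
  have [measurable]: "\<tau> \<in> borel_measurable borel" "G \<in> borel_measurable borel"
    using \<tau>(5) sG(4) by (auto intro: borel_measurable_continuous_onI)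
  \<comment> \<open>The factor \<open>B\<close> undoes the normalisation, \<tau> deletes the atom,
    and \<open>G\<close> turns codes back into points.\<close>
  define P0 where "P0 = density N (\<lambda>t. ennreal (B * \<tau> t))"
  define P1 where "P1 = distr P0 borel G"
  define P where "P = restrict_space P1 K"
  have conv: "(\<lambda>n. integral\<^sup>L (\<pi> (r n)) F) \<longlonglongrightarrow> integral\<^sup>L P1 F"
    if F: "continuous_on UNIV F" "\<And>x. \<bar>F x\<bar> \<le> C" for F :: "'b \<Rightarrow> real" and C
  proof -
    \<comment> \<open>Test functions are pulled back through the continuous \<open>G\<close>, so
      \<open>h\<close> is bounded and continuous and weak convergence applies although
      \<open>s\<close> is not continuous.\<close>
    define h where "h t = B * (\<tau> t * F (G t))" for t
    have ch: "continuous_on UNIV h"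
      unfolding h_def using F(1) sG(4) \<tau>(5)
      by (intro continuous_intros) (auto intro: continuous_on_compose2[of UNIV])
    have [measurable]: "h \<in> borel_measurable borel" "F \<in> borel_measurable borel"
      using ch F(1) by (auto intro: borel_measurable_continuous_onI)
    have C: "0 \<le> C" using F(2)[of 0] by simp
    have bh: "\<bar>h t\<bar> \<le> B * C" for t
    proof -
      have "\<bar>\<tau> t * F (G t)\<bar> \<le> 1 * C"
        unfolding abs_mult using \<tau>(1,2)[of t] F(2)[of "G t"] C by (intro mult_mono) auto
      then show ?thesis using B by (simp add: h_def abs_mult)
    qed
    have ih: "integral\<^sup>L (\<nu> n) h = integral\<^sup>L (\<pi> n) F" for n
    proof -
      interpret d: finite_measure "distr (\<pi> n) borel s"
        by (rule \<pi>.finite_measure_distr) simp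
      have i1: "integrable (distr (\<pi> n) borel s) h"
        by (rule d.integrable_const_bound[of _ "B * C"]) (auto simp: bh)
      have i2: "integrable (density (return borel (-1)) (\<lambda>_. ennreal (B - measure (\<pi> n) K))) h"
      proof -
        have "integrable (return borel (-1)) h"
          using prob_space_return[of "-1" "borel :: real measure"] bh
          by (intro finite_measure.integrable_const_bound[of _ _ "B * C"])
             (auto simp: prob_space_def cong: measurable_cong_sets)
        then show ?thesis
          using mB[of n] by (subst integrable_real_density) (auto cong: measurable_cong_sets)
      qed
      have "integral\<^sup>L (\<nu> n) h = 1 / B * (integral\<^sup>L (distr (\<pi> n) borel s) h
          + integral\<^sup>L (density (return borel (-1)) (\<lambda>_. ennreal (B - measure (\<pi> n) K))) h)"
        unfolding \<nu>_def using B i1 i2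
        by (subst integral_const_density) (auto simp: integral_add_measure cong: measurable_cong_sets)
      also have "integral\<^sup>L (density (return borel (-1)) (\<lambda>_. ennreal (B - measure (\<pi> n) K))) h
          = (B - measure (\<pi> n) K) * h (-1)"
        using mB[of n] by (subst integral_const_density) (auto simp: integral_return cong: measurable_cong_sets)
      also have "h (-1) = 0" by (simp add: h_def \<tau>)
      also have "integral\<^sup>L (distr (\<pi> n) borel s) h = integral\<^sup>L (\<pi> n) (\<lambda>x. h (s x))"
        by (rule integral_distr) auto
      also have "\<dots> = integral\<^sup>L (\<pi> n) (\<lambda>x. B * F x)"
        by (rule Bochner_Integration.integral_cong) (auto simp: h_def sp sG \<tau>)
      finally show ?thesis using B by simp
    qed
    have "(\<lambda>n. integral\<^sup>L ((\<nu> \<circ> r) n) h) \<longlonglongrightarrow> integral\<^sup>L N h"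
      using ch bh rd
      by (intro weak_conv_imp_integral_bdd_continuous_conv[OF _ N, where B = "B * C"])
         (auto simp: continuous_on_eq_continuous_at)
    also have "integral\<^sup>L N h = integral\<^sup>L P1 F"
      unfolding P1_def P0_def h_def using B \<tau>(1)
      by (subst integral_distr, simp, simp, subst integral_real_density) (auto simp: mult.assoc)
    finally show ?thesis by (simp add: ih)
  qed
  have P1: "sets P1 = sets borel" "finite_measure P1"
  proof -
    show "sets P1 = sets borel" by (simp add: P1_def)
    have "emeasure P0 (space P0) = (\<integral>\<^sup>+t. ennreal (B * \<tau> t) \<partial>N)"
      by (simp add: P0_def emeasure_density)
    also have "\<dots> \<le> (\<integral>\<^sup>+t. ennreal B \<partial>N)"
      using B \<tau> by (intro nn_integral_mono ennreal_leI) (auto intro: mult_left_le)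
    also have "\<dots> < top" using N.emeasure_space_1 by (simp add: ennreal_mult_less_top less_top)
    finally interpret finite_measure P0 by (intro finite_measureI) auto
    show "finite_measure P1"
      unfolding P1_def by (rule finite_measure_distr) (simp add: P0_def)
  qed
  interpret P1: finite_measure P1 by fact
  \<comment> \<open>The limit could a priori charge numbers that are no codes. The truncated
    distance to \<open>K\<close> integrates to 0 along the sequence, hence in the limit, so decoding
    leads into \<open>K\<close> almost everywhere.\<close>
  have aeK: "AE x in P1. x \<in> K"
  proof -
    define F where "F x = min 1 (infdist x K)" for x
    have cF: "continuous_on UNIV F" unfolding F_def by (intro continuous_intros)
    have bF: "0 \<le> F x" "\<bar>F x\<bar> \<le> 1" for x by (auto simp: F_def infdist_nonneg)
    have "integral\<^sup>L (\<pi> n) F = integral\<^sup>L (\<pi> n) (\<lambda>_. 0)" for n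
      by (rule Bochner_Integration.integral_cong) (auto simp: F_def sp)
    then have "integral\<^sup>L P1 F = 0"
      using conv[OF cF bF(2)] by (simp add: LIMSEQ_const_iff)
    moreover have "integrable P1 F"
      using bF borel_measurable_continuous_onI[OF cF] P1(1)
      by (intro P1.integrable_const_bound[of _ 1]) (auto cong: measurable_cong_sets)
    ultimately have "AE x in P1. F x = 0"
      using bF by (simp add: integral_nonneg_eq_0_iff_AE)
    then show ?thesis
    proof eventually_elim
      case (elim x)
      then have "infdist x K = 0" by (simp add: F_def min_def split: if_splits)
      then show ?case using cK K(2) by (simp add: in_closed_iff_infdist_zero)
    qed
  qed
  have P: "P \<in> finite_borel_measures K"
    using P1 sets_restrict_space_cong[OF P1(1), of K] finite_measure_restrict_space[OF P1(2), of K]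
    by (simp add: finite_borel_measures_def P_def)
  have lim: "(\<lambda>n. integral\<^sup>L (\<pi> (r n)) f) \<longlonglongrightarrow> integral\<^sup>L P f" if f: "continuous_on K f" for f :: "'b \<Rightarrow> real"
  proof -
    have "bounded (f ` K)"
      using K f by (intro compact_imp_bounded compact_continuous_image)
    then obtain C where C: "\<And>x. x \<in> K \<Longrightarrow> \<bar>f x\<bar> \<le> C"
      by (auto simp: bounded_iff)
    have "0 \<le> C" using C K(2) by force
    obtain F where F: "continuous_on UNIV F" "\<And>x. x \<in> K \<Longrightarrow> F x = f x" "\<And>x. F x \<in> cbox (-C) C"
      using Tietze_closed_interval_1[of K f UNIV "-C" C] f cK C \<open>0 \<le> C\<close> by (auto simp: abs_le_iff minus_le_iff)
    have "(\<lambda>n. integral\<^sup>L (\<pi> (r n)) F) \<longlonglongrightarrow> integral\<^sup>L P1 F"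
      using F(1,3) by (intro conv[of _ C]) (auto simp: abs_le_iff minus_le_iff)
    also have "(\<lambda>n. integral\<^sup>L (\<pi> (r n)) F) = (\<lambda>n. integral\<^sup>L (\<pi> (r n)) f)"
      by (intro ext Bochner_Integration.integral_cong) (auto simp: F sp)
    also have "integral\<^sup>L P1 F = integral\<^sup>L P1 (\<lambda>x. indicator K x *\<^sub>R F x)"
      using aeK borel_measurable_continuous_onI[OF F(1)] P1(1)
      by (intro integral_cong_AE) (auto cong: measurable_cong_sets)
    also have "\<dots> = integral\<^sup>L P F"
      unfolding P_def using P1(1) by (intro integral_restrict_space[symmetric]) auto
    also have "\<dots> = integral\<^sup>L P f"
      using fbmD(2)[OF P] by (intro Bochner_Integration.integral_cong) (auto simp: F)
    finally show ?thesis .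
  qed
  have "(\<lambda>n. measure (\<pi> (r n)) K) \<longlonglongrightarrow> measure P K"
    using lim[of "\<lambda>_. 1"] by (simp add: fbmD(2)[OF \<pi>(1)] fbmD(2)[OF P])
  then have "measure P K \<le> M"
    using \<pi>(2) by (intro LIMSEQ_le_const2) auto
  then show thesis
    using that[OF r P _ lim] by blast
qed

section \<open>Linear programming over measures\<close>

text \<open>The direct method. The infimum is taken in \<open>ereal\<close>, so no lower bound on
  \<open>F\<close> has to be assumed; convergence to \<open>F P\<close> shows afterwards that it is
  finite.\<close>

lemma weak_attains_min:
  fixes K :: "'b::euclidean_space set" and F :: "'b measure \<Rightarrow> real"
  assumes K: "compact K" "K \<noteq> {}"
    and ne: "\<rho> \<in> finite_borel_measures K" "measure \<rho> K \<le> M"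
    and F: "\<And>\<pi> P. (\<And>n. \<pi> n \<in> finite_borel_measures K) \<Longrightarrow> P \<in> finite_borel_measures K
      \<Longrightarrow> (\<And>f :: 'b \<Rightarrow> real. continuous_on K f \<Longrightarrow> (\<lambda>n. integral\<^sup>L (\<pi> n) f) \<longlonglongrightarrow> integral\<^sup>L P f)
      \<Longrightarrow> (\<lambda>n::nat. F (\<pi> n)) \<longlonglongrightarrow> F P"
  shows "\<exists>P\<in>finite_borel_measures K. measure P K \<le> M \<and>
    (\<forall>\<pi>\<in>finite_borel_measures K. measure \<pi> K \<le> M \<longrightarrow> F P \<le> F \<pi>)"
proof -
  define S where "S = {\<pi> \<in> finite_borel_measures K. measure \<pi> K \<le> M}"
  define A where "A = (\<lambda>\<pi>. ereal (F \<pi>)) ` S"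
  have "A \<noteq> {}" using ne by (auto simp: A_def S_def)
  then obtain u where u: "\<And>n. u n \<in> A" "u \<longlonglongrightarrow> Inf A"
    using Inf_as_limit by blast
  have "\<exists>\<pi>. \<pi> \<in> S \<and> u n = ereal (F \<pi>)" for n using u(1)[of n] by (auto simp: A_def)
  then obtain \<pi> where \<pi>: "\<And>n. \<pi> n \<in> S" "\<And>n. u n = ereal (F (\<pi> n))" by metis
  obtain r P where r: "strict_mono (r :: nat \<Rightarrow> nat)" and P: "P \<in> finite_borel_measures K" "measure P K \<le> M"
    and lim: "\<And>f :: 'b \<Rightarrow> real. continuous_on K f \<Longrightarrow> (\<lambda>n. integral\<^sup>L (\<pi> (r n)) f) \<longlonglongrightarrow> integral\<^sup>L P f"
    using \<pi>(1) by (auto simp: S_def intro: fbm_weak_compactness[OF K, of \<pi> M])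
  have "(\<lambda>n. F (\<pi> (r n))) \<longlonglongrightarrow> F P"
    using \<pi>(1) P lim by (intro F) (auto simp: S_def)
  then have "(\<lambda>n. u (r n)) \<longlonglongrightarrow> ereal (F P)" by (simp add: \<pi>(2))
  moreover have "(\<lambda>n. u (r n)) \<longlonglongrightarrow> Inf A"
    using LIMSEQ_subseq_LIMSEQ[OF u(2) r] by (simp add: o_def)
  ultimately have "Inf A = ereal (F P)" by (rule LIMSEQ_unique[symmetric])
  moreover have "Inf A \<le> ereal (F \<pi>)" if "\<pi> \<in> S" for \<pi>
    using that by (auto simp: A_def intro: Inf_lower)
  ultimately show ?thesis using P by (auto simp: S_def)
qed

text \<open>This extracts first order conditions: for small \<open>t\<close> the term
  \<open>t\<^sup>2 * B\<close> cannot compensate a negative slope \<open>A\<close>.\<close>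

lemma nonneg_of_quadratic_bound:
  fixes A B \<tau> :: real
  assumes "\<tau> > 0" and le: "\<And>t. 0 < t \<Longrightarrow> t \<le> \<tau> \<Longrightarrow> 0 \<le> t * A + t\<^sup>2 * B"
  shows "0 \<le> A"
proof (rule ccontr)
  assume "\<not> 0 \<le> A"
  then have A: "A < 0" by simp
  \<comment> \<open>The second bound gives \<open>t * B \<le> - A / 2\<close>, so
    \<open>A + t * B\<close> would still be negative.\<close>
  define t where "t = min \<tau> (- A / (2 * (\<bar>B\<bar> + 1)))"
  have t: "0 < t" "t \<le> \<tau>" "t \<le> - A / (2 * (\<bar>B\<bar> + 1))"
    using assms(1) A by (auto simp: t_def intro: divide_neg_pos)
  have "t * A + t\<^sup>2 * B = t * (A + t * B)" by (simp add: power2_eq_square algebra_simps)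
  then have "0 \<le> A + t * B" using le[OF t(1,2)] t(1) by (simp add: zero_le_mult_iff)
  also have "t * B \<le> t * (\<bar>B\<bar> + 1)" using t(1) by (intro mult_left_mono) auto
  also have "\<dots> \<le> - A / 2" using t(3) by (simp add: field_simps)
  finally show False using A by simp
qed

text \<open>
  The equality constraints are enforced by a quadratic penalty; its derivative at the minimiser \<open>p N\<close>
  gives the multipliers \<open>l k = 2 N d k\<close>. Adding a small atom at \<open>z\<close>, possible as long as the mass
  is below \<open>M\<close>, yields dual feasibility, and shrinking \<open>p N\<close> yields complementary slackness.
\<close>

lemma moment_problem_duality:
  fixes K :: "'b::euclidean_space set" and C :: "'b \<Rightarrow> real" and h :: "nat \<Rightarrow> 'b \<Rightarrow> real" and a :: "nat \<Rightarrow> real"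
  assumes K: "compact K" "K \<noteq> {}"
    and C: "continuous_on K C" and h: "\<And>k. continuous_on K (h k)"
    and \<rho>: "\<rho> \<in> finite_borel_measures K" "measure \<rho> K \<le> M" "\<And>k. integral\<^sup>L \<rho> (h k) = a k"
  obtains P where "P \<in> finite_borel_measures K" "measure P K \<le> M" "\<And>k. integral\<^sup>L P (h k) = a k"
    "\<And>\<pi>. \<pi> \<in> finite_borel_measures K \<Longrightarrow> measure \<pi> K \<le> M \<Longrightarrow> (\<And>k. integral\<^sup>L \<pi> (h k) = a k)
      \<Longrightarrow> integral\<^sup>L P C \<le> integral\<^sup>L \<pi> C"
    "\<And>\<epsilon>. measure P K < M \<Longrightarrow> \<epsilon> > 0 \<Longrightarrow>
      \<exists>N l. (\<forall>z\<in>K. 0 \<le> C z + (\<Sum>k<N. l k * h k z)) \<and> integral\<^sup>L P C - \<epsilon> \<le> - (\<Sum>k<N. l k * a k)"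
proof -
  \<comment> \<open>The \<open>n\<close>-th energy has finitely many penalty terms, yet every fixed
    constraint is eventually present with a weight that tends to infinity.\<close>
  define E where "E n \<pi> = integral\<^sup>L \<pi> C + real n * (\<Sum>k<n. (integral\<^sup>L \<pi> (h k) - a k)\<^sup>2)" for n \<pi>
  have "\<exists>P\<in>finite_borel_measures K. measure P K \<le> M \<and>
    (\<forall>\<pi>\<in>finite_borel_measures K. measure \<pi> K \<le> M \<longrightarrow> E n P \<le> E n \<pi>)" for n
  proof (rule weak_attains_min[OF K \<rho>(1,2)])
    fix \<pi> :: "nat \<Rightarrow> 'b measure" and P
    assume lim: "\<And>f :: 'b \<Rightarrow> real. continuous_on K f \<Longrightarrow> (\<lambda>n. integral\<^sup>L (\<pi> n) f) \<longlonglongrightarrow> integral\<^sup>L P f"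
    show "(\<lambda>m. E n (\<pi> m)) \<longlonglongrightarrow> E n P"
      unfolding E_def by (intro tendsto_intros lim C h)
  qed
  then obtain p where p: "\<And>n. p n \<in> finite_borel_measures K" "\<And>n. measure (p n) K \<le> M"
    "\<And>n \<pi>. \<pi> \<in> finite_borel_measures K \<Longrightarrow> measure \<pi> K \<le> M \<Longrightarrow> E n (p n) \<le> E n \<pi>"
    by metis
  obtain r P where r: "strict_mono (r :: nat \<Rightarrow> nat)" and P: "P \<in> finite_borel_measures K" "measure P K \<le> M"
    and lim: "\<And>f :: 'b \<Rightarrow> real. continuous_on K f \<Longrightarrow> (\<lambda>n. integral\<^sup>L (p (r n)) f) \<longlonglongrightarrow> integral\<^sup>L P f"
    using p by (auto intro: fbm_weak_compactness[OF K, of p M])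
  \<comment> \<open>An exactly feasible competitor pays no penalty, so its plain cost bounds the
    full energy of \<open>p n\<close>.\<close>
  have Eb: "integral\<^sup>L (p n) C + real n * (\<Sum>k<n. (integral\<^sup>L (p n) (h k) - a k)\<^sup>2) \<le> integral\<^sup>L \<pi> C"
    if "\<pi> \<in> finite_borel_measures K" "measure \<pi> K \<le> M" "\<And>k. integral\<^sup>L \<pi> (h k) = a k" for \<pi> n
    using p(3)[OF that(1,2), of n] that(3) by (simp add: E_def)
  have opt: "integral\<^sup>L P C \<le> integral\<^sup>L \<pi> C"
    if "\<pi> \<in> finite_borel_measures K" "measure \<pi> K \<le> M" "\<And>k. integral\<^sup>L \<pi> (h k) = a k" for \<pi>
  proof (rule LIMSEQ_le_const2[OF lim[OF C]], intro exI allI impI)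
    fix n
    have "0 \<le> real (r n) * (\<Sum>k<r n. (integral\<^sup>L (p (r n)) (h k) - a k)\<^sup>2)"
      by (intro mult_nonneg_nonneg sum_nonneg) auto
    then show "integral\<^sup>L (p (r n)) C \<le> integral\<^sup>L \<pi> C" using Eb[OF that, of "r n"] by linarith
  qed
  have feas: "integral\<^sup>L P (h k) = a k" for k
  proof -
    define x where "x n = (integral\<^sup>L (p (r n)) (h k) - a k)\<^sup>2" for n
    have x: "x \<longlonglongrightarrow> (integral\<^sup>L P (h k) - a k)\<^sup>2"
      unfolding x_def by (intro tendsto_intros lim h)
    \<comment> \<open>The penalty is at most the cost gap to \<rho>. Division by the weight
      \<open>r n\<close> bounds the squared violation of constraint \<open>k\<close> by
      \<open>y n\<close>, once \<open>k < r n\<close>; and \<open>y\<close> tends to 0.\<close>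
    define y where "y n = (integral\<^sup>L \<rho> C - integral\<^sup>L (p (r n)) C) * inverse (real (r n))" for n
    have "y \<longlonglongrightarrow> (integral\<^sup>L \<rho> C - integral\<^sup>L P C) * 0"
      unfolding y_def
      using LIMSEQ_subseq_LIMSEQ[OF lim_inverse_n r]
      by (intro tendsto_intros lim C) (simp add: o_def)
    moreover have "x n \<le> y n" if "n \<ge> Suc k" for n
    proof -
      have rn: "k < r n" using seq_suble[OF r, of n] that by linarith
      have "x n \<le> (\<Sum>k<r n. (integral\<^sup>L (p (r n)) (h k) - a k)\<^sup>2)"
        unfolding x_def using rn by (intro member_le_sum) auto
      then have "real (r n) * x n \<le> real (r n) * (\<Sum>k<r n. (integral\<^sup>L (p (r n)) (h k) - a k)\<^sup>2)"
        by (intro mult_left_mono) auto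
      also have "\<dots> \<le> integral\<^sup>L \<rho> C - integral\<^sup>L (p (r n)) C"
        using Eb[OF \<rho>, of "r n"] by linarith
      finally show ?thesis using rn by (simp add: y_def field_simps)
    qed
    ultimately have "(integral\<^sup>L P (h k) - a k)\<^sup>2 \<le> 0"
      using LIMSEQ_le[OF x] by fastforce
    then show ?thesis by simp
  qed
  have dual: "\<exists>N l. (\<forall>z\<in>K. 0 \<le> C z + (\<Sum>k<N. l k * h k z)) \<and> integral\<^sup>L P C - \<epsilon> \<le> - (\<Sum>k<N. l k * a k)"
    if m: "measure P K < M" and \<epsilon>: "\<epsilon> > 0" for \<epsilon>
  proof -
    \<comment> \<open>The constant 1 is a test function, so for late \<open>n\<close> the mass of
      \<open>p (r n)\<close> is below \<open>M\<close> as well. That gap is the room for an added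
      atom.\<close>
    have "(\<lambda>n. measure (p (r n)) K) \<longlonglongrightarrow> measure P K"
      using lim[of "\<lambda>_. 1"] by (simp add: fbmD(2)[OF p(1)] fbmD(2)[OF P(1)])
    then have "\<forall>\<^sub>F n in sequentially. measure (p (r n)) K < M"
      using m by (rule order_tendstoD)
    moreover have "\<forall>\<^sub>F n in sequentially. integral\<^sup>L (p (r n)) C > integral\<^sup>L P C - \<epsilon>"
      using \<epsilon> by (intro order_tendstoD(1)[OF lim[OF C]]) simp
    ultimately have "\<forall>\<^sub>F n in sequentially. measure (p (r n)) K < M \<and> integral\<^sup>L (p (r n)) C > integral\<^sup>L P C - \<epsilon>"
      by (rule eventually_conj)
    then obtain n where n: "measure (p (r n)) K < M" "integral\<^sup>L (p (r n)) C > integral\<^sup>L P C - \<epsilon>"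
      by (auto simp: eventually_sequentially)
    define N where "N = r n"
    define d where "d k = integral\<^sup>L (p N) (h k) - a k" for k
    define l where "l k = 2 * real N * d k" for k
    have q: "p N \<in> finite_borel_measures K" by (rule p)
    \<comment> \<open>Exact expansion of the energy along \<open>p N + t * \<sigma>\<close>. It is
      used with \<sigma> the unit atom at \<open>z\<close> and \<open>t > 0\<close>, and with
      \<sigma> = \<open>p N\<close> and a negative step, which shrinks \<open>p N\<close> and so
      respects the mass cap.\<close>
    have varied: "0 \<le> t * (integral\<^sup>L \<sigma> C + (\<Sum>k<N. l k * integral\<^sup>L \<sigma> (h k)))
        + t\<^sup>2 * (real N * (\<Sum>k<N. (integral\<^sup>L \<sigma> (h k))\<^sup>2))"
      if "\<pi> \<in> finite_borel_measures K" "measure \<pi> K \<le> M"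
        and e: "\<And>f :: 'b \<Rightarrow> real. continuous_on K f \<Longrightarrow> integral\<^sup>L \<pi> f = integral\<^sup>L (p N) f + t * integral\<^sup>L \<sigma> f"
      for \<pi> t and \<sigma> :: "'b measure"
    proof -
      have "E N \<pi> = integral\<^sup>L (p N) C + t * integral\<^sup>L \<sigma> C + real N * (\<Sum>k<N. (d k + t * integral\<^sup>L \<sigma> (h k))\<^sup>2)"
        by (simp add: E_def e C h d_def algebra_simps)
      also have "(\<Sum>k<N. (d k + t * integral\<^sup>L \<sigma> (h k))\<^sup>2) = (\<Sum>k<N. (d k)\<^sup>2) +
          t * (\<Sum>k<N. 2 * d k * integral\<^sup>L \<sigma> (h k)) + t\<^sup>2 * (\<Sum>k<N. (integral\<^sup>L \<sigma> (h k))\<^sup>2)"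
        by (simp add: power2_sum sum.distrib sum_distrib_left power_mult_distrib algebra_simps)
      also have "real N * \<dots> = real N * (\<Sum>k<N. (d k)\<^sup>2) +
          t * (\<Sum>k<N. l k * integral\<^sup>L \<sigma> (h k)) + t\<^sup>2 * (real N * (\<Sum>k<N. (integral\<^sup>L \<sigma> (h k))\<^sup>2))"
        by (simp add: l_def sum_distrib_left algebra_simps)
      finally show ?thesis
        using p(3)[OF that(1,2), of N] by (simp add: E_def d_def algebra_simps)
    qed
    have pos: "0 \<le> C z + (\<Sum>k<N. l k * h k z)" if z: "z \<in> K" for z
    proof (rule nonneg_of_quadratic_bound)
      show "0 < M - measure (p N) K" using n(1) by (simp add: N_def)
      fix t assume t: "0 < t" "t \<le> M - measure (p N) K"
      let ?\<pi> = "add_measure (p N) (density (return (restrict_space borel K) z) (\<lambda>_. ennreal t))"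
      let ?\<sigma> = "return (restrict_space borel K) z"
      have \<pi>: "?\<pi> \<in> finite_borel_measures K"
        and i\<pi>: "\<And>f :: 'b \<Rightarrow> real. continuous_on K f \<Longrightarrow> integral\<^sup>L ?\<pi> f = integral\<^sup>L (p N) f + t * f z"
        using integral_fbm_add_atom[OF K(1) q z, of t] t(1) by auto
      have i\<sigma>: "integral\<^sup>L ?\<sigma> f = f z" if "continuous_on K f" for f :: "'b \<Rightarrow> real"
        using borel_measurable_continuous_on_restrict[OF that] z
        by (intro integral_return) (auto simp: space_restrict_space)
      have "measure ?\<pi> K \<le> M"
        using i\<pi>[of "\<lambda>_. 1"] t(2) by (simp add: fbmD(2)[OF q])
      from varied[OF \<pi> this, of t ?\<sigma>]
      show "0 \<le> t * (C z + (\<Sum>k<N. l k * h k z)) + t\<^sup>2 * (real N * (\<Sum>k<N. (h k z)\<^sup>2))"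
        by (simp add: i\<pi> i\<sigma> C h)
    qed
    have "0 \<le> - (integral\<^sup>L (p N) C + (\<Sum>k<N. l k * integral\<^sup>L (p N) (h k)))"
    proof (rule nonneg_of_quadratic_bound)
      show "(0::real) < 1" by simp
      fix t :: real assume t: "0 < t" "t \<le> 1"
      let ?\<pi> = "density (p N) (\<lambda>_. ennreal (1 - t))"
      have \<pi>: "?\<pi> \<in> finite_borel_measures K" by (rule fbm_density_const[OF q])
      have i\<pi>: "integral\<^sup>L ?\<pi> f = integral\<^sup>L (p N) f + (- t) * integral\<^sup>L (p N) f"
        if "continuous_on K f" for f :: "'b \<Rightarrow> real"
        using t fbm_borel_measurable[OF q that] by (simp add: integral_const_density algebra_simps)
      have "measure ?\<pi> K \<le> measure (p N) K"
        using i\<pi>[of "\<lambda>_. 1"] t by (simp add: fbmD(2)[OF q])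
      also have "\<dots> \<le> M" by (rule p)
      finally have "measure ?\<pi> K \<le> M" .
      from varied[OF \<pi> this i\<pi>]
      show "0 \<le> t * - (integral\<^sup>L (p N) C + (\<Sum>k<N. l k * integral\<^sup>L (p N) (h k)))
          + t\<^sup>2 * (real N * (\<Sum>k<N. (integral\<^sup>L (p N) (h k))\<^sup>2))"
        by (simp add: algebra_simps)
    qed
    moreover have "(\<Sum>k<N. l k * integral\<^sup>L (p N) (h k)) = (\<Sum>k<N. l k * d k) + (\<Sum>k<N. l k * a k)"
      by (simp add: d_def sum.distrib[symmetric] algebra_simps)
    moreover have "0 \<le> (\<Sum>k<N. l k * d k)"
      by (intro sum_nonneg) (simp add: l_def)
    ultimately have "integral\<^sup>L P C - \<epsilon> \<le> - (\<Sum>k<N. l k * a k)"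
      using n(2) by (simp add: N_def)
    then show ?thesis using pos by blast
  qed
  show thesis
    by (rule that[OF P feas opt dual])
qed

section \<open>Plans and test functions vanishing on the boundary\<close>

text \<open>Uniqueness from an intersection-stable generator, applied to the traces of
  \<open>E\<close> on \<open>S\<close>. \<open>UNIV \<in> E\<close> makes \<open>S\<close> itself a
  generator set, and its finite measure serves as the exhaustion.\<close>

lemma fbm_restrict_space_eqI:
  fixes \<Omega> :: "'a::euclidean_space set"
  assumes \<Omega>: "closed \<Omega>" and \<mu>: "\<mu> \<in> finite_borel_measures \<Omega>" and \<nu>: "\<nu> \<in> finite_borel_measures \<Omega>"
    and S: "open S" "S \<subseteq> \<Omega>" and E: "Int_stable E" "borel = sigma UNIV E" "UNIV \<in> E"
    and eq: "\<And>U. U \<in> E \<Longrightarrow> measure \<mu> (U \<inter> S) = measure \<nu> (U \<inter> S)"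
  shows "restrict_space \<mu> S = restrict_space \<nu> S"
proof -
  interpret \<mu>: finite_measure \<mu> using \<mu> by (rule fbmD)
  interpret \<nu>: finite_measure \<nu> using \<nu> by (rule fbmD)
  have sb: "sets borel = sigma_sets UNIV E" unfolding E(2) by simp
  then have b: "U \<in> sets borel" if "U \<in> E" for U using that by auto
  have in\<mu>: "A \<inter> S \<in> sets \<mu>" "A \<inter> S \<in> sets \<nu>" if "A \<in> sets borel" for A
    using that S \<Omega> fbmD(1)[OF \<mu>] fbmD(1)[OF \<nu>] by (auto simp: sets_restrict_space_iff)
  have S\<mu>: "S \<in> sets \<mu>" "S \<in> sets \<nu>" using in\<mu>[of UNIV] by auto
  define G where "G = (\<inter>) S ` E"
  have st: "sets (restrict_space \<rho> S) = sigma_sets S G" if "\<rho> \<in> finite_borel_measures \<Omega>" for \<rho>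
  proof -
    have "sets (restrict_space \<rho> S) = (\<inter>) S ` (\<inter>) \<Omega> ` sets borel"
      using fbmD(1)[OF that] by (simp add: sets_restrict_space)
    also have "\<dots> = (\<inter>) S ` sets borel"
      using S(2) by (auto simp: image_image Int_assoc[symmetric] Int_absorb2)
    also note sb
    also have "(\<inter>) S ` sigma_sets UNIV E = sigma_sets S G"
      unfolding G_def by (rule sigma_sets_Int) (use borel_open[OF S(1)] sb in auto)
    finally show ?thesis .
  qed
  show ?thesis
  proof (rule measure_eqI_generator_eq[where E = G and \<Omega> = S and A = "\<lambda>_. S"])
    show "Int_stable G"
    proof (rule Int_stableI)
      fix a b assume "a \<in> G" "b \<in> G"
      then obtain U V where "U \<in> E" "V \<in> E" "a = S \<inter> U" "b = S \<inter> V" by (auto simp: G_def)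
      then show "a \<inter> b \<in> G"
        using E(1) by (auto simp: G_def Int_stable_def intro!: image_eqI[of _ _ "U \<inter> V"])
    qed
    show "G \<subseteq> Pow S" by (auto simp: G_def)
    show "sets (restrict_space \<mu> S) = sigma_sets S G" "sets (restrict_space \<nu> S) = sigma_sets S G"
      using st \<mu> \<nu> by auto
    show "range (\<lambda>_::nat. S) \<subseteq> G" using E(3) by (auto simp: G_def)
    show "emeasure (restrict_space \<mu> S) X = emeasure (restrict_space \<nu> S) X" if "X \<in> G" for X
    proof -
      obtain U where U: "U \<in> E" "X = U \<inter> S" using \<open>X \<in> G\<close> by (auto simp: G_def)
      have "emeasure \<mu> X = emeasure \<nu> X"
        using eq[OF U(1)] by (simp add: U(2) \<mu>.emeasure_eq_measure \<nu>.emeasure_eq_measure)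
      then show ?thesis
        using U S\<mu> by (simp add: emeasure_restrict_space)
    qed
    show "emeasure (restrict_space \<mu> S) S \<noteq> \<infinity>"
      using S\<mu> by (simp add: emeasure_restrict_space)
  qed auto
qed

text \<open>The integrands are continuous, vanish off \<open>W\<close> and tend to its indicator,
  since points of \<open>W\<close> have positive distance to the complement.
  \<open>W \<noteq> UNIV\<close> matters because \<open>infdist\<close> to the empty set is 0 by
  convention.\<close>

lemma measure_open_eq_limit:
  fixes \<Omega> :: "'a::euclidean_space set"
  assumes \<Omega>: "closed \<Omega>" and \<mu>: "\<mu> \<in> finite_borel_measures \<Omega>"
    and W: "open W" "W \<subseteq> \<Omega>" "W \<noteq> UNIV"
  shows "(\<lambda>k. LINT x|\<mu>. min 1 (real k * infdist x (- W))) \<longlonglongrightarrow> measure \<mu> W"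
proof -
  interpret finite_measure \<mu> using \<mu> by (rule fbmD)
  have m: "(\<lambda>x. min 1 (real k * infdist x (- W))) \<in> borel_measurable \<mu>" for k
    by (rule fbm_borel_measurable[OF \<mu>]) (intro continuous_intros)
  have W\<mu>: "W \<in> sets \<mu>"
    using W \<Omega> fbmD(1)[OF \<mu>] by (simp add: sets_restrict_space_iff)
  have "(\<lambda>k. LINT x|\<mu>. min 1 (real k * infdist x (- W))) \<longlonglongrightarrow> (LINT x|\<mu>. indicator W x)"
  proof (rule integral_dominated_convergence[where w = "\<lambda>_. 1"])
    show "AE x in \<mu>. (\<lambda>k. min 1 (real k * infdist x (- W))) \<longlonglongrightarrow> indicator W x"
    proof (rule AE_I2)
      fix x
      show "(\<lambda>k. min 1 (real k * infdist x (- W))) \<longlonglongrightarrow> indicator W x"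
      proof (cases "x \<in> W")
        case False
        then show ?thesis by simp
      next
        case True
        then have "infdist x (- W) \<noteq> 0"
          using W in_closed_iff_infdist_zero[of "- W" x] by auto
        then have pos: "infdist x (- W) > 0" using infdist_nonneg[of x "- W"] by linarith
        obtain n :: nat where n: "1 / infdist x (- W) < n" using reals_Archimedean2 by blast
        have "min 1 (real k * infdist x (- W)) = 1" if "k \<ge> n" for k
        proof -
          have "1 / infdist x (- W) \<le> real k" using n that by linarith
          then have "1 \<le> real k * infdist x (- W)" using pos by (simp add: field_simps)
          then show ?thesis by simp
        qed
        then have "\<forall>\<^sub>F k in sequentially. min 1 (real k * infdist x (- W)) = 1"
          by (auto simp: eventually_sequentially)
        then show ?thesis using True by (simp add: tendsto_eventually)
      qed
    qed
    show "AE x in \<mu>. norm (min 1 (real k * infdist x (- W))) \<le> 1" for k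
      by (auto simp: infdist_nonneg)
  qed (use m W\<mu> in auto)
  then show ?thesis using W\<mu> by simp
qed

text \<open>Cutoffs approximating the indicators of \<open>U \<inter> interior \<Omega>\<close>, for
  \<open>U\<close> in a countable base closed under finite intersections, determine a measure on the
  interior. They vanish on the boundary because these sets lie in the interior. The empty
  intersection supplies \<open>UNIV\<close>.\<close>

lemma countable_determining_family:
  fixes \<Omega> :: "'a::euclidean_space set"
  assumes \<Omega>: "compact \<Omega>"
  obtains u :: "nat \<Rightarrow> 'a \<Rightarrow> real"
  where "\<And>j. continuous_on UNIV (u j)" "\<And>j x. x \<in> frontier \<Omega> \<Longrightarrow> u j x = 0"
    "\<And>\<mu> \<nu>. \<mu> \<in> finite_borel_measures \<Omega> \<Longrightarrow> \<nu> \<in> finite_borel_measures \<Omega>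
      \<Longrightarrow> (\<And>j. integral\<^sup>L \<mu> (u j) = integral\<^sup>L \<nu> (u j))
      \<Longrightarrow> restrict_space \<mu> (interior \<Omega>) = restrict_space \<nu> (interior \<Omega>)"
proof -
  have cl: "closed \<Omega>" using \<Omega> by (rule compact_imp_closed)
  obtain B :: "'a set set" where B: "countable B" "topological_basis B"
    using ex_countable_basis by auto
  define E where "E = Inter ` {F. finite F \<and> F \<subseteq> B}"
  have cE: "countable E"
    unfolding E_def using B(1) by (intro countable_image countable_Collect_finite_subset)
  have oE: "open U" if "U \<in> E" for U
    using that topological_basis_open[OF B(2)] by (auto simp: E_def intro!: open_Inter)
  have BE: "B \<subseteq> E"
    by (auto simp: E_def intro!: image_eqI[where x = "{b}" for b])
  have bE: "topological_basis E"
    using B(2) BE oE unfolding topological_basis_def by (meson subset_trans)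
  have stE: "Int_stable E"
  proof (rule Int_stableI)
    fix a b assume "a \<in> E" "b \<in> E"
    then obtain F G where "finite F" "F \<subseteq> B" "finite G" "G \<subseteq> B" "a = \<Inter>F" "b = \<Inter>G"
      by (auto simp: E_def)
    then show "a \<inter> b \<in> E"
      by (auto simp: E_def intro!: image_eqI[where x = "F \<union> G"])
  qed
  have UE: "UNIV \<in> E" by (auto simp: E_def intro!: image_eqI[where x = "{}"])
  have bo: "borel = sigma UNIV E" by (rule borel_eq_countable_basis[OF cE bE])
  have nU: "interior \<Omega> \<noteq> UNIV"
    using \<Omega> interior_subset[of \<Omega>] not_compact_UNIV by (metis top.extremum_uniqueI)
  define e where "e = from_nat_into (E \<times> (UNIV :: nat set))"
  have re: "range e = E \<times> UNIV"
    unfolding e_def using cE UE by (intro range_from_nat_into) auto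
  define u where "u j x = min 1 (real (snd (e j)) * infdist x (- (fst (e j) \<inter> interior \<Omega>)))" for j and x :: 'a
  show thesis
  proof (rule that[of u])
    show "continuous_on UNIV (u j)" for j unfolding u_def by (intro continuous_intros)
    show "u j x = 0" if "x \<in> frontier \<Omega>" for j x
      using that by (auto simp: u_def frontier_def)
    show "restrict_space \<mu> (interior \<Omega>) = restrict_space \<nu> (interior \<Omega>)"
      if \<mu>: "\<mu> \<in> finite_borel_measures \<Omega>" and \<nu>: "\<nu> \<in> finite_borel_measures \<Omega>"
        and eq: "\<And>j. integral\<^sup>L \<mu> (u j) = integral\<^sup>L \<nu> (u j)" for \<mu> \<nu>
    proof (rule fbm_restrict_space_eqI[OF cl \<mu> \<nu> open_interior interior_subset stE bo UE])
      fix U assume U: "U \<in> E"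
      have W: "open (U \<inter> interior \<Omega>)" "U \<inter> interior \<Omega> \<subseteq> \<Omega>" "U \<inter> interior \<Omega> \<noteq> UNIV"
        using oE[OF U] interior_subset[of \<Omega>] nU by auto
      have "(LINT x|\<mu>. min 1 (real k * infdist x (- (U \<inter> interior \<Omega>)))) =
          (LINT x|\<nu>. min 1 (real k * infdist x (- (U \<inter> interior \<Omega>))))" for k
      proof -
        have "(U, k) \<in> range e" using U re by auto
        then obtain j where "e j = (U, k)" by force
        then have "u j = (\<lambda>x. min 1 (real k * infdist x (- (U \<inter> interior \<Omega>))))"
          by (simp add: u_def fun_eq_iff)
        then show ?thesis using eq[of j] by simp
      qed
      then show "measure \<mu> (U \<inter> interior \<Omega>) = measure \<nu> (U \<inter> interior \<Omega>)"
        using measure_open_eq_limit[OF cl \<mu> W] measure_open_eq_limit[OF cl \<nu> W]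
        by (simp add: LIMSEQ_unique)
    qed
  qed
qed

section \<open>Marginals of plans and their boundary parts\<close>

lemma fbm_integral_split:
  fixes \<Omega> :: "'a::euclidean_space set" and f :: "'a \<Rightarrow> real"
  assumes \<Omega>: "compact \<Omega>" and \<mu>: "\<mu> \<in> finite_borel_measures \<Omega>" and f: "continuous_on \<Omega> f"
  shows "integral\<^sup>L \<mu> f = integral\<^sup>L (restrict_space \<mu> (interior \<Omega>)) f + (LINT x:frontier \<Omega>|\<mu>. f x)"
proof -
  have cl: "closed \<Omega>" using \<Omega> by (rule compact_imp_closed)
  have i: "interior \<Omega> \<in> sets \<mu>" "frontier \<Omega> \<in> sets \<mu>"
    using cl interior_subset[of \<Omega>] frontier_subset_closed[OF cl] fbmD(1)[OF \<mu>]
    by (auto simp: sets_restrict_space_iff)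
  have int: "integrable \<mu> f" using fbm_integrable[OF \<Omega> \<mu> f] .
  have "integral\<^sup>L \<mu> f = (LINT x|\<mu>. indicator (interior \<Omega>) x *\<^sub>R f x + indicator (frontier \<Omega>) x *\<^sub>R f x)"
  proof (rule Bochner_Integration.integral_cong)
    fix x assume "x \<in> space \<mu>"
    then have "x \<in> \<Omega>" using fbmD(2)[OF \<mu>] by simp
    then show "f x = indicator (interior \<Omega>) x *\<^sub>R f x + indicator (frontier \<Omega>) x *\<^sub>R f x"
      using closure_subset[of \<Omega>] by (auto simp: frontier_def indicator_def)
  qed simp
  also have "\<dots> = (LINT x|\<mu>. indicator (interior \<Omega>) x *\<^sub>R f x) + (LINT x|\<mu>. indicator (frontier \<Omega>) x *\<^sub>R f x)"
    using int i by (intro Bochner_Integration.integral_add integrable_mult_indicator)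
  finally show ?thesis
    using i by (simp add: integral_restrict_space set_lebesgue_integral_def)
qed

lemma marginal_fbm:
  fixes \<Omega> :: "'a::euclidean_space set"
  assumes "\<pi> \<in> finite_borel_measures (\<Omega> \<times> \<Omega>)"
  shows "marginal_x \<Omega> \<pi> \<in> finite_borel_measures \<Omega>" "marginal_y \<Omega> \<pi> \<in> finite_borel_measures \<Omega>"
    and "fst \<in> measurable \<pi> (restrict_space borel \<Omega>)" "snd \<in> measurable \<pi> (restrict_space borel \<Omega>)"
proof -
  interpret finite_measure \<pi> using assms by (rule fbmD)
  have "(fst :: 'a \<times> 'a \<Rightarrow> 'a) \<in> borel_measurable borel" "(snd :: 'a \<times> 'a \<Rightarrow> 'a) \<in> borel_measurable borel"
    by (auto intro!: borel_measurable_continuous_onI continuous_intros)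
  then have "fst \<in> measurable (restrict_space borel (\<Omega> \<times> \<Omega>)) (restrict_space borel \<Omega>)"
    "snd \<in> measurable (restrict_space borel (\<Omega> \<times> \<Omega>)) (restrict_space borel \<Omega>)"
    by (auto intro!: measurable_restrict_space3)
  then show f: "fst \<in> measurable \<pi> (restrict_space borel \<Omega>)" "snd \<in> measurable \<pi> (restrict_space borel \<Omega>)"
    using fbmD(1)[OF assms] by (simp_all cong: measurable_cong_sets)
  show "marginal_x \<Omega> \<pi> \<in> finite_borel_measures \<Omega>" "marginal_y \<Omega> \<pi> \<in> finite_borel_measures \<Omega>"
    using f by (auto simp: finite_borel_measures_def marginal_x_def marginal_y_def intro!: finite_measure_distr)
qed

lemma marginal_integral:
  fixes \<Omega> :: "'a::euclidean_space set" and f :: "'a \<Rightarrow> real"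
  assumes "\<pi> \<in> finite_borel_measures (\<Omega> \<times> \<Omega>)" "continuous_on \<Omega> f"
  shows "integral\<^sup>L (marginal_x \<Omega> \<pi>) f = (LINT z|\<pi>. f (fst z))"
    and "integral\<^sup>L (marginal_y \<Omega> \<pi>) f = (LINT z|\<pi>. f (snd z))"
  using marginal_fbm(3,4)[OF assms(1)] borel_measurable_continuous_on_restrict[OF assms(2)]
  by (auto simp: marginal_x_def marginal_y_def integral_distr)

lemma integral_frontier_null:
  fixes \<Omega> :: "'a::euclidean_space set" and f :: "'a \<Rightarrow> real"
  assumes \<Omega>: "compact \<Omega>" and \<mu>: "\<mu> \<in> finite_borel_measures \<Omega>" "emeasure \<mu> (frontier \<Omega>) = 0"
  shows "(LINT x:frontier \<Omega>|\<mu>. f x) = 0"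
proof -
  have cl: "closed \<Omega>" using \<Omega> by (rule compact_imp_closed)
  have "frontier \<Omega> \<in> null_sets \<mu>"
    using cl frontier_subset_closed[OF cl] fbmD(1)[OF \<mu>(1)] \<mu>(2)
    by (auto simp: null_sets_def sets_restrict_space_iff)
  then show ?thesis
    unfolding set_lebesgue_integral_def
    by (intro integral_eq_zero_AE) (auto dest: AE_not_in elim!: eventually_mono)
qed

text \<open>The marginals agree with \<open>\<mu>p\<close> and \<open>\<mu>m\<close> in the
  interior, and these have no boundary mass. So the marginals exceed them exactly by their boundary
  parts, and the boundary terms of the cost become integrals against the plan up to a
  constant.\<close>

lemma plan_integral:
  fixes \<Omega> :: "'a::euclidean_space set" and f :: "'a \<Rightarrow> real"
  assumes \<Omega>: "compact \<Omega>"
    and \<mu>p: "\<mu>p \<in> finite_borel_measures \<Omega>" "emeasure \<mu>p (frontier \<Omega>) = 0"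
    and \<mu>m: "\<mu>m \<in> finite_borel_measures \<Omega>" "emeasure \<mu>m (frontier \<Omega>) = 0"
    and \<pi>: "\<pi> \<in> plans \<Omega> \<mu>p \<mu>m" and f: "continuous_on \<Omega> f"
  shows "(LINT z|\<pi>. f (fst z)) = integral\<^sup>L \<mu>p f + (LINT x:frontier \<Omega>|marginal_x \<Omega> \<pi>. f x)"
    and "(LINT z|\<pi>. f (snd z)) = integral\<^sup>L \<mu>m f + (LINT x:frontier \<Omega>|marginal_y \<Omega> \<pi>. f x)"
proof -
  have p: "\<pi> \<in> finite_borel_measures (\<Omega> \<times> \<Omega>)"
    "restrict_space (marginal_x \<Omega> \<pi>) (interior \<Omega>) = restrict_space \<mu>p (interior \<Omega>)"
    "restrict_space (marginal_y \<Omega> \<pi>) (interior \<Omega>) = restrict_space \<mu>m (interior \<Omega>)"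
    using \<pi> by (auto simp: plans_def)
  note m = marginal_fbm(1,2)[OF p(1)]
  show "(LINT z|\<pi>. f (fst z)) = integral\<^sup>L \<mu>p f + (LINT x:frontier \<Omega>|marginal_x \<Omega> \<pi>. f x)"
    using fbm_integral_split[OF \<Omega> m(1) f] fbm_integral_split[OF \<Omega> \<mu>p(1) f]
    by (simp add: marginal_integral[OF p(1) f] p integral_frontier_null[OF \<Omega> \<mu>p])
  show "(LINT z|\<pi>. f (snd z)) = integral\<^sup>L \<mu>m f + (LINT x:frontier \<Omega>|marginal_y \<Omega> \<pi>. f x)"
    using fbm_integral_split[OF \<Omega> m(2) f] fbm_integral_split[OF \<Omega> \<mu>m(1) f]
    by (simp add: marginal_integral[OF p(1) f] p integral_frontier_null[OF \<Omega> \<mu>m])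
qed

section \<open>Competitors: removal of boundary pairs, and a plan through one boundary point\<close>

lemma set_integral_zero:
  assumes "\<And>x. x \<in> S \<Longrightarrow> f x = (0::real)"
  shows "(LINT x:S|\<mu>. f x) = 0"
  unfolding set_lebesgue_integral_def
  by (rule integral_eq_zero_AE) (use assms in \<open>auto simp: indicator_def\<close>)

text \<open>Functions that vanish on the boundary do not see pairs of boundary points, so removing
  these pairs keeps all moments. Every remaining pair has a coordinate in the interior, where the
  marginals are prescribed; this bounds the remaining mass.\<close>

lemma plans_discard_frontier:
  fixes \<Omega> :: "'a::euclidean_space set" and C :: "'a \<times> 'a \<Rightarrow> real"
  assumes \<Omega>: "compact \<Omega>"
    and \<mu>p: "\<mu>p \<in> finite_borel_measures \<Omega>" "emeasure \<mu>p (frontier \<Omega>) = 0"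
    and \<mu>m: "\<mu>m \<in> finite_borel_measures \<Omega>" "emeasure \<mu>m (frontier \<Omega>) = 0"
    and \<pi>: "\<pi> \<in> plans \<Omega> \<mu>p \<mu>m" and C: "continuous_on (\<Omega> \<times> \<Omega>) C"
  obtains \<rho> where "\<rho> \<in> finite_borel_measures (\<Omega> \<times> \<Omega>)"
    "\<And>f. continuous_on \<Omega> f \<Longrightarrow> (\<And>x. x \<in> frontier \<Omega> \<Longrightarrow> f x = (0::real)) \<Longrightarrow>
      (LINT z|\<rho>. f (fst z)) = integral\<^sup>L \<mu>p f \<and> (LINT z|\<rho>. f (snd z)) = integral\<^sup>L \<mu>m f"
    "measure \<rho> (\<Omega> \<times> \<Omega>) = measure \<pi> (\<Omega> \<times> \<Omega>) - measure \<pi> (frontier \<Omega> \<times> frontier \<Omega>)"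
    "measure \<rho> (\<Omega> \<times> \<Omega>) \<le> measure \<mu>p \<Omega> + measure \<mu>m \<Omega>"
    "integral\<^sup>L \<rho> C = integral\<^sup>L \<pi> C - (LINT z:frontier \<Omega> \<times> frontier \<Omega>|\<pi>. C z)"
proof -
  have cl: "closed \<Omega>" using \<Omega> by (rule compact_imp_closed)
  have p: "\<pi> \<in> finite_borel_measures (\<Omega> \<times> \<Omega>)"
    "restrict_space (marginal_x \<Omega> \<pi>) (interior \<Omega>) = restrict_space \<mu>p (interior \<Omega>)"
    "restrict_space (marginal_y \<Omega> \<pi>) (interior \<Omega>) = restrict_space \<mu>m (interior \<Omega>)"
    using \<pi> by (auto simp: plans_def)
  have cK: "compact (\<Omega> \<times> \<Omega>)" using \<Omega> by (intro compact_Times)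
  interpret \<pi>: finite_measure \<pi> using p(1) by (rule fbmD)
  interpret \<mu>p: finite_measure \<mu>p using \<mu>p(1) by (rule fbmD)
  interpret \<mu>m: finite_measure \<mu>m using \<mu>m(1) by (rule fbmD)
  have sp: "space \<pi> = \<Omega> \<times> \<Omega>" using p(1) by (rule fbmD)
  have in\<pi>: "A \<in> sets \<pi>" if "A \<in> sets borel" "A \<subseteq> \<Omega> \<times> \<Omega>" for A
    using that cl fbmD(1)[OF p(1)] by (auto simp: sets_restrict_space_iff borel_closed closed_Times)
  define F where "F = frontier \<Omega> \<times> frontier \<Omega>"
  have F: "F \<in> sets \<pi>" "F \<subseteq> \<Omega> \<times> \<Omega>"
    using frontier_subset_closed[OF cl] unfolding F_def
    by (auto intro!: in\<pi> borel_closed closed_Times)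
  define D where "D = \<Omega> \<times> \<Omega> - F"
  have D: "D \<in> sets \<pi>" using F sp unfolding D_def by (metis sets.Diff sets.top)
  \<comment> \<open>A density keeps \<open>\<Omega> \<times> \<Omega>\<close> as the space;
    \<open>restrict_space\<close> would shrink it to \<open>D\<close>.\<close>
  define \<rho> where "\<rho> = density \<pi> (\<lambda>z. ennreal (indicator D z))"
  have em: "emeasure \<rho> A = emeasure \<pi> (D \<inter> A)" if "A \<in> sets \<pi>" for A
    using that D by (simp add: \<rho>_def ennreal_indicator emeasure_restricted)
  have sr: "sets \<rho> = sets \<pi>" "space \<rho> = \<Omega> \<times> \<Omega>" by (simp_all add: \<rho>_def sp)
  have \<rho>: "\<rho> \<in> finite_borel_measures (\<Omega> \<times> \<Omega>)"
    using em[of "\<Omega> \<times> \<Omega>"] sets.top[of \<pi>] fbmD(1)[OF p(1)] sr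
    by (auto simp: finite_borel_measures_def sp \<pi>.emeasure_eq_measure intro!: finite_measureI)
  have i\<rho>: "integral\<^sup>L \<rho> f = (LINT z|\<pi>. indicator D z * f z)" if "f \<in> borel_measurable \<pi>" for f :: "'a \<times> 'a \<Rightarrow> real"
    using that D by (simp add: \<rho>_def integral_real_density)
  have meas: "measure \<rho> (\<Omega> \<times> \<Omega>) = measure \<pi> D"
    using em[of "\<Omega> \<times> \<Omega>"] sets.top[of \<pi>] by (simp add: measure_def sp D_def Int_absorb2)
  have mD: "measure \<pi> D = measure \<pi> (\<Omega> \<times> \<Omega>) - measure \<pi> F"
    unfolding D_def using F sets.top[of \<pi>] by (intro \<pi>.finite_measure_Diff) (auto simp: sp)
  have bound: "measure \<pi> D \<le> measure \<mu>p \<Omega> + measure \<mu>m \<Omega>"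
  proof -
    have I: "interior \<Omega> \<in> sets (restrict_space borel \<Omega>)"
      using cl interior_subset[of \<Omega>] by (auto simp: sets_restrict_space_iff)
    have "measure \<pi> (fst -` interior \<Omega> \<inter> space \<pi>) = measure (marginal_x \<Omega> \<pi>) (interior \<Omega>)"
      using I marginal_fbm(3)[OF p(1)] by (simp add: marginal_x_def measure_distr)
    also have "\<dots> = measure (restrict_space (marginal_x \<Omega> \<pi>) (interior \<Omega>)) (interior \<Omega>)"
      using I fbmD(1)[OF marginal_fbm(1)[OF p(1)]] by (simp add: measure_restrict_space)
    also have "\<dots> = measure \<mu>p (interior \<Omega>)"
      unfolding p(2) using I fbmD(1)[OF \<mu>p(1)] by (simp add: measure_restrict_space)
    also have "\<dots> \<le> measure \<mu>p \<Omega>"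
      using interior_subset[of \<Omega>] fbmD(2)[OF \<mu>p(1)] by (metis \<mu>p.bounded_measure)
    finally have x: "measure \<pi> (fst -` interior \<Omega> \<inter> space \<pi>) \<le> measure \<mu>p \<Omega>" .
    have "measure \<pi> (snd -` interior \<Omega> \<inter> space \<pi>) = measure (marginal_y \<Omega> \<pi>) (interior \<Omega>)"
      using I marginal_fbm(4)[OF p(1)] by (simp add: marginal_y_def measure_distr)
    also have "\<dots> = measure (restrict_space (marginal_y \<Omega> \<pi>) (interior \<Omega>)) (interior \<Omega>)"
      using I fbmD(1)[OF marginal_fbm(2)[OF p(1)]] by (simp add: measure_restrict_space)
    also have "\<dots> = measure \<mu>m (interior \<Omega>)"
      unfolding p(3) using I fbmD(1)[OF \<mu>m(1)] by (simp add: measure_restrict_space)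
    also have "\<dots> \<le> measure \<mu>m \<Omega>"
      using interior_subset[of \<Omega>] fbmD(2)[OF \<mu>m(1)] by (metis \<mu>m.bounded_measure)
    finally have y: "measure \<pi> (snd -` interior \<Omega> \<inter> space \<pi>) \<le> measure \<mu>m \<Omega>" .
    have s: "fst -` interior \<Omega> \<inter> space \<pi> \<in> sets \<pi>" "snd -` interior \<Omega> \<inter> space \<pi> \<in> sets \<pi>"
      using I marginal_fbm(3,4)[OF p(1)] by (auto intro: measurable_sets)
    have "D \<subseteq> (fst -` interior \<Omega> \<inter> space \<pi>) \<union> (snd -` interior \<Omega> \<inter> space \<pi>)"
      using closure_subset[of \<Omega>] by (auto simp: D_def F_def sp frontier_def)
    then have "measure \<pi> D \<le> measure \<pi> ((fst -` interior \<Omega> \<inter> space \<pi>) \<union> (snd -` interior \<Omega> \<inter> space \<pi>))"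
      using s by (intro \<pi>.finite_measure_mono) auto
    also have "\<dots> \<le> measure \<pi> (fst -` interior \<Omega> \<inter> space \<pi>) + measure \<pi> (snd -` interior \<Omega> \<inter> space \<pi>)"
      using s by (intro measure_Un_le)
    finally show ?thesis using x y by linarith
  qed
  show thesis
  proof (rule that[OF \<rho>])
    fix f :: "'a \<Rightarrow> real" assume f: "continuous_on \<Omega> f" "\<And>x. x \<in> frontier \<Omega> \<Longrightarrow> f x = 0"
    have c: "continuous_on (\<Omega> \<times> \<Omega>) (\<lambda>z. f (fst z))" "continuous_on (\<Omega> \<times> \<Omega>) (\<lambda>z. f (snd z))"
      by (rule continuous_on_compose2[OF f(1)]; auto intro!: continuous_intros)+
    have "(LINT z|\<rho>. f (fst z)) = (LINT z|\<pi>. f (fst z))" "(LINT z|\<rho>. f (snd z)) = (LINT z|\<pi>. f (snd z))"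
      by (subst i\<rho>[OF fbm_borel_measurable[OF p(1)]], fact c,
          rule Bochner_Integration.integral_cong, simp, auto simp: D_def F_def sp f(2) indicator_def)+
    then show "(LINT z|\<rho>. f (fst z)) = integral\<^sup>L \<mu>p f \<and> (LINT z|\<rho>. f (snd z)) = integral\<^sup>L \<mu>m f"
      using plan_integral[OF \<Omega> \<mu>p \<mu>m \<pi> f(1)] by (simp add: set_integral_zero f(2))
  next
    have "integral\<^sup>L \<pi> C = (LINT z|\<pi>. indicator D z * C z + indicator F z * C z)"
      by (rule Bochner_Integration.integral_cong) (auto simp: sp D_def indicator_def)
    also have "\<dots> = (LINT z|\<pi>. indicator D z * C z) + (LINT z|\<pi>. indicator F z * C z)"
      using integrable_mult_indicator[OF D fbm_integrable[OF cK p(1) C]]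
        integrable_mult_indicator[OF F(1) fbm_integrable[OF cK p(1) C]]
      by (intro Bochner_Integration.integral_add) simp_all
    finally show "integral\<^sup>L \<rho> C = integral\<^sup>L \<pi> C - (LINT z:frontier \<Omega> \<times> frontier \<Omega>|\<pi>. C z)"
      using i\<rho>[OF fbm_borel_measurable[OF p(1) C]] by (simp add: set_lebesgue_integral_def F_def)
  qed (use meas mD bound in \<open>auto simp: F_def\<close>)
qed

text \<open>One boundary point \<open>z\<close> serves as both sink and source: all of
  \<open>\<mu>p\<close> is sent to \<open>z\<close>, and all of \<open>\<mu>m\<close> is supplied
  from it. The mass arriving at or leaving \<open>z\<close> is invisible to functions vanishing on
  the boundary.\<close>

lemma plan_exists:
  fixes \<Omega> :: "'a::euclidean_space set"
  assumes \<Omega>: "compact \<Omega>" "z \<in> frontier \<Omega>"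
    and \<mu>p: "\<mu>p \<in> finite_borel_measures \<Omega>" and \<mu>m: "\<mu>m \<in> finite_borel_measures \<Omega>"
  obtains \<rho> where "\<rho> \<in> finite_borel_measures (\<Omega> \<times> \<Omega>)"
    "\<And>f. continuous_on \<Omega> f \<Longrightarrow> (\<And>x. x \<in> frontier \<Omega> \<Longrightarrow> f x = (0::real)) \<Longrightarrow>
      (LINT z|\<rho>. f (fst z)) = integral\<^sup>L \<mu>p f \<and> (LINT z|\<rho>. f (snd z)) = integral\<^sup>L \<mu>m f"
    "measure \<rho> (\<Omega> \<times> \<Omega>) = measure \<mu>p \<Omega> + measure \<mu>m \<Omega>"
proof -
  have cK: "compact (\<Omega> \<times> \<Omega>)" using \<Omega> by (intro compact_Times)
  have z: "z \<in> \<Omega>" using \<Omega> frontier_subset_closed compact_imp_closed by blast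
  define K where "K = restrict_space borel (\<Omega> \<times> \<Omega>)"
  define A where "A = distr \<mu>p K (\<lambda>x. (x, z))"
  define B where "B = distr \<mu>m K (\<lambda>y. (z, y))"
  have g: "(\<lambda>x. (x, z)) \<in> measurable \<mu>p K" "(\<lambda>y. (z, y)) \<in> measurable \<mu>m K"
  proof -
    have "(\<lambda>x::'a. (x, z)) \<in> measurable borel borel" "(\<lambda>y::'a. (z, y)) \<in> measurable borel borel"
      by (auto intro!: borel_measurable_continuous_onI continuous_intros)
    then have "(\<lambda>x. (x, z)) \<in> measurable (restrict_space borel \<Omega>) K"
      "(\<lambda>y. (z, y)) \<in> measurable (restrict_space borel \<Omega>) K"
      unfolding K_def using z by (auto intro!: measurable_restrict_space3)
    then show "(\<lambda>x. (x, z)) \<in> measurable \<mu>p K" "(\<lambda>y. (z, y)) \<in> measurable \<mu>m K"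
      using fbmD(1)[OF \<mu>p] fbmD(1)[OF \<mu>m] by (simp_all cong: measurable_cong_sets)
  qed
  have AB: "A \<in> finite_borel_measures (\<Omega> \<times> \<Omega>)" "B \<in> finite_borel_measures (\<Omega> \<times> \<Omega>)"
    using finite_measure.finite_measure_distr[OF fbmD(3)[OF \<mu>p] g(1)]
      finite_measure.finite_measure_distr[OF fbmD(3)[OF \<mu>m] g(2)]
    by (auto simp: A_def B_def finite_borel_measures_def K_def)
  have s: "sets A = sets B" by (simp add: A_def B_def)
  have i: "integral\<^sup>L (add_measure A B) f = (LINT x|\<mu>p. f (x, z)) + (LINT y|\<mu>m. f (z, y))"
    if f: "continuous_on (\<Omega> \<times> \<Omega>) f" for f :: "'a \<times> 'a \<Rightarrow> real"
  proof -
    have "f \<in> borel_measurable K"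
      unfolding K_def by (rule borel_measurable_continuous_on_restrict[OF f])
    then show ?thesis
      using g integral_add_measure[OF s fbm_integrable[OF cK AB(1) f] fbm_integrable[OF cK AB(2) f]]
      by (simp add: A_def B_def integral_distr)
  qed
  have P: "add_measure A B \<in> finite_borel_measures (\<Omega> \<times> \<Omega>)" by (intro fbm_add_measure AB)
  show thesis
  proof (rule that[OF P])
    fix f :: "'a \<Rightarrow> real" assume f: "continuous_on \<Omega> f" "\<And>x. x \<in> frontier \<Omega> \<Longrightarrow> f x = 0"
    have "continuous_on (\<Omega> \<times> \<Omega>) (\<lambda>z. f (fst z))" "continuous_on (\<Omega> \<times> \<Omega>) (\<lambda>z. f (snd z))"
      by (rule continuous_on_compose2[OF f(1)]; auto intro!: continuous_intros)+
    then show "(LINT z|add_measure A B. f (fst z)) = integral\<^sup>L \<mu>p f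
        \<and> (LINT z|add_measure A B. f (snd z)) = integral\<^sup>L \<mu>m f"
      using f(2)[OF \<Omega>(2)] by (simp add: i)
  next
    show "measure (add_measure A B) (\<Omega> \<times> \<Omega>) = measure \<mu>p \<Omega> + measure \<mu>m \<Omega>"
      using i[of "\<lambda>_. 1"] fbmD(2)[OF AB(1)] fbmD(2)[OF \<mu>p] fbmD(2)[OF \<mu>m] by simp
  qed
qed

text \<open>
  For \<open>\<delta> > 0\<close> a minimiser charges no pair of boundary points, so its mass stays strictly below
  the bound \<open>M\<close>.
\<close>

lemma plans_minimum_and_duality:
  fixes \<Omega> :: "'a::euclidean_space set" and C :: "'a \<times> 'a \<Rightarrow> real"
  assumes \<Omega>: "compact \<Omega>" "\<Omega> \<noteq> {}"
    and \<mu>p: "\<mu>p \<in> finite_borel_measures \<Omega>" "emeasure \<mu>p (frontier \<Omega>) = 0"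
    and \<mu>m: "\<mu>m \<in> finite_borel_measures \<Omega>" "emeasure \<mu>m (frontier \<Omega>) = 0"
    and C: "continuous_on (\<Omega> \<times> \<Omega>) C"
    and \<delta>: "0 \<le> \<delta>" "\<And>x y. x \<in> frontier \<Omega> \<Longrightarrow> y \<in> frontier \<Omega> \<Longrightarrow> \<delta> \<le> C (x, y)"
  obtains P where "P \<in> plans \<Omega> \<mu>p \<mu>m" "\<And>\<pi>. \<pi> \<in> plans \<Omega> \<mu>p \<mu>m \<Longrightarrow> integral\<^sup>L P C \<le> integral\<^sup>L \<pi> C"
    "\<And>\<epsilon>. \<delta> > 0 \<Longrightarrow> \<epsilon> > 0 \<Longrightarrow> \<exists>u v. continuous_on \<Omega> u \<and> continuous_on \<Omega> v
      \<and> (\<forall>x\<in>frontier \<Omega>. u x = 0 \<and> v x = 0) \<and> (\<forall>x\<in>\<Omega>. \<forall>y\<in>\<Omega>. 0 \<le> C (x, y) + u x + v y)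
      \<and> integral\<^sup>L P C - \<epsilon> \<le> - integral\<^sup>L \<mu>p u - integral\<^sup>L \<mu>m v"
proof -
  have cl: "closed \<Omega>" using \<Omega> compact_imp_closed by blast
  have cK: "compact (\<Omega> \<times> \<Omega>)" "\<Omega> \<times> \<Omega> \<noteq> {}" using \<Omega> by (auto intro: compact_Times)
  have "frontier \<Omega> \<noteq> {}"
    using \<Omega> not_compact_UNIV frontier_eq_empty[of \<Omega>] by auto
  then obtain z0 where z0: "z0 \<in> frontier \<Omega>" by auto
  \<comment> \<open>The summand 1 is the slack that keeps the cap inactive.\<close>
  define M where "M = measure \<mu>p \<Omega> + measure \<mu>m \<Omega> + 1"
  obtain w :: "nat \<Rightarrow> 'a \<Rightarrow> real" where w: "\<And>j. continuous_on UNIV (w j)" "\<And>j x. x \<in> frontier \<Omega> \<Longrightarrow> w j x = 0"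
    and det: "\<And>\<mu> \<nu>. \<mu> \<in> finite_borel_measures \<Omega> \<Longrightarrow> \<nu> \<in> finite_borel_measures \<Omega>
      \<Longrightarrow> (\<And>j. integral\<^sup>L \<mu> (w j) = integral\<^sup>L \<nu> (w j))
      \<Longrightarrow> restrict_space \<mu> (interior \<Omega>) = restrict_space \<nu> (interior \<Omega>)"
    using countable_determining_family[OF \<Omega>(1)] by metis
  have cw: "continuous_on S (w j)" for S j using w(1) by (rule continuous_on_subset) simp
  \<comment> \<open>Even indices test the first coordinate and odd ones the second, which merges
    both marginal constraints into one sequence.\<close>
  define h where "h k z = (if even k then w (k div 2) (fst z) else w (k div 2) (snd z))" for k and z :: "'a \<times> 'a"
  define a where "a k = (if even k then integral\<^sup>L \<mu>p (w (k div 2)) else integral\<^sup>L \<mu>m (w (k div 2)))" for k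
  have hs: "h (2 * j) = (\<lambda>z. w j (fst z))" "h (Suc (2 * j)) = (\<lambda>z. w j (snd z))" for j
    by (auto simp: h_def fun_eq_iff)
  have as: "a (2 * j) = integral\<^sup>L \<mu>p (w j)" "a (Suc (2 * j)) = integral\<^sup>L \<mu>m (w j)" for j
    by (auto simp: a_def)
  have ch: "continuous_on (\<Omega> \<times> \<Omega>) (h k)" for k
  proof -
    have "continuous_on (\<Omega> \<times> \<Omega>) (\<lambda>z. w (k div 2) (fst z))" "continuous_on (\<Omega> \<times> \<Omega>) (\<lambda>z. w (k div 2) (snd z))"
      by (rule continuous_on_compose2[OF w(1)]; auto intro!: continuous_intros)+
    then show ?thesis by (cases "even k") (auto simp: h_def[abs_def])
  qed
  have momentsI: "integral\<^sup>L \<pi> (h k) = a k"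
    if "\<And>f. continuous_on \<Omega> f \<Longrightarrow> (\<And>x. x \<in> frontier \<Omega> \<Longrightarrow> f x = (0::real)) \<Longrightarrow>
      (LINT z|\<pi>. f (fst z)) = integral\<^sup>L \<mu>p f \<and> (LINT z|\<pi>. f (snd z)) = integral\<^sup>L \<mu>m f" for \<pi> k
    using that[OF cw w(2), of "k div 2"] by (cases "even k") (auto simp: h_def[abs_def] a_def)
  have plansI: "\<pi> \<in> plans \<Omega> \<mu>p \<mu>m"
    if \<pi>: "\<pi> \<in> finite_borel_measures (\<Omega> \<times> \<Omega>)" and m: "\<And>k. integral\<^sup>L \<pi> (h k) = a k" for \<pi>
  proof -
    have "integral\<^sup>L (marginal_x \<Omega> \<pi>) (w j) = integral\<^sup>L \<mu>p (w j)"
      "integral\<^sup>L (marginal_y \<Omega> \<pi>) (w j) = integral\<^sup>L \<mu>m (w j)" for j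
      using m[of "2 * j"] m[of "Suc (2 * j)"] by (simp_all add: marginal_integral[OF \<pi> cw] hs as)
    then show ?thesis
      using \<pi> det[OF marginal_fbm(1)[OF \<pi>] \<mu>p(1)] det[OF marginal_fbm(2)[OF \<pi>] \<mu>m(1)]
      by (simp add: plans_def)
  qed
  obtain \<rho> where \<rho>: "\<rho> \<in> finite_borel_measures (\<Omega> \<times> \<Omega>)" "measure \<rho> (\<Omega> \<times> \<Omega>) \<le> M" "\<And>k. integral\<^sup>L \<rho> (h k) = a k"
    by (rule plan_exists[OF \<Omega>(1) z0 \<mu>p(1) \<mu>m(1)]) (rule that, auto simp: M_def intro: momentsI)
  obtain P where P: "P \<in> finite_borel_measures (\<Omega> \<times> \<Omega>)" "measure P (\<Omega> \<times> \<Omega>) \<le> M" "\<And>k. integral\<^sup>L P (h k) = a k"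
    and min: "\<And>\<pi>. \<pi> \<in> finite_borel_measures (\<Omega> \<times> \<Omega>) \<Longrightarrow> measure \<pi> (\<Omega> \<times> \<Omega>) \<le> M \<Longrightarrow> (\<And>k. integral\<^sup>L \<pi> (h k) = a k)
      \<Longrightarrow> integral\<^sup>L P C \<le> integral\<^sup>L \<pi> C"
    and dual: "\<And>\<epsilon>. measure P (\<Omega> \<times> \<Omega>) < M \<Longrightarrow> \<epsilon> > 0 \<Longrightarrow>
      \<exists>N l. (\<forall>z\<in>\<Omega> \<times> \<Omega>. 0 \<le> C z + (\<Sum>k<N. l k * h k z)) \<and> integral\<^sup>L P C - \<epsilon> \<le> - (\<Sum>k<N. l k * a k)"
    by (rule moment_problem_duality[where h = h and a = a, OF cK C ch \<rho>]) (rule that; blast)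
  have PP: "P \<in> plans \<Omega> \<mu>p \<mu>m" by (rule plansI[OF P(1,3)])
  have frontier_nonneg: "\<delta> * measure \<pi> (frontier \<Omega> \<times> frontier \<Omega>) \<le> (LINT z:frontier \<Omega> \<times> frontier \<Omega>|\<pi>. C z)"
    if "\<pi> \<in> plans \<Omega> \<mu>p \<mu>m" for \<pi>
  proof -
    have \<pi>: "\<pi> \<in> finite_borel_measures (\<Omega> \<times> \<Omega>)" using that by (simp add: plans_def)
    interpret finite_measure \<pi> using \<pi> by (rule fbmD)
    have F: "frontier \<Omega> \<times> frontier \<Omega> \<in> sets \<pi>"
      using frontier_subset_closed[OF cl] cl fbmD(1)[OF \<pi>]
      by (auto simp: sets_restrict_space_iff borel_closed closed_Times)
    have "\<delta> * measure \<pi> (frontier \<Omega> \<times> frontier \<Omega>) = (LINT z|\<pi>. indicator (frontier \<Omega> \<times> frontier \<Omega>) z *\<^sub>R \<delta>)"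
      using F by (simp add: mult.commute)
    also have "\<dots> \<le> (LINT z|\<pi>. indicator (frontier \<Omega> \<times> frontier \<Omega>) z *\<^sub>R C z)"
      using F \<delta>(2) fbm_integrable[OF cK(1) \<pi> C]
      by (intro integral_mono integrable_mult_indicator) (auto simp: indicator_def)
    finally show ?thesis by (simp add: set_lebesgue_integral_def)
  qed
  \<comment> \<open>The competitor is \<pi> without its boundary pairs, which obeys the cap whatever
    the mass of \<pi>. The choice \<pi> = \<open>P\<close> shows that the boundary pairs of
    \<open>P\<close> cost at most 0, so for \<delta> > 0 they carry no mass.\<close>
  have opt: "integral\<^sup>L P C + (LINT z:frontier \<Omega> \<times> frontier \<Omega>|\<pi>. C z) \<le> integral\<^sup>L \<pi> C"
    if "\<pi> \<in> plans \<Omega> \<mu>p \<mu>m" for \<pi>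
  proof (rule plans_discard_frontier[OF \<Omega>(1) \<mu>p \<mu>m that C])
    fix \<sigma> assume \<sigma>: "\<sigma> \<in> finite_borel_measures (\<Omega> \<times> \<Omega>)"
      "\<And>f. continuous_on \<Omega> f \<Longrightarrow> (\<And>x. x \<in> frontier \<Omega> \<Longrightarrow> f x = (0::real)) \<Longrightarrow>
      (LINT z|\<sigma>. f (fst z)) = integral\<^sup>L \<mu>p f \<and> (LINT z|\<sigma>. f (snd z)) = integral\<^sup>L \<mu>m f"
      "measure \<sigma> (\<Omega> \<times> \<Omega>) \<le> measure \<mu>p \<Omega> + measure \<mu>m \<Omega>"
      "integral\<^sup>L \<sigma> C = integral\<^sup>L \<pi> C - (LINT z:frontier \<Omega> \<times> frontier \<Omega>|\<pi>. C z)"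
    have m: "integral\<^sup>L \<sigma> (h k) = a k" for k
      by (rule momentsI) (rule \<sigma>(2))
    have "measure \<sigma> (\<Omega> \<times> \<Omega>) \<le> M" using \<sigma>(3) by (simp add: M_def)
    from min[OF \<sigma>(1) this m] show ?thesis using \<sigma>(4) by simp
  qed
  show thesis
  proof (rule that[OF PP])
    fix \<pi> assume \<pi>: "\<pi> \<in> plans \<Omega> \<mu>p \<mu>m"
    have "0 \<le> \<delta> * measure \<pi> (frontier \<Omega> \<times> frontier \<Omega>)" using \<delta>(1) by simp
    then show "integral\<^sup>L P C \<le> integral\<^sup>L \<pi> C"
      using opt[OF \<pi>] frontier_nonneg[OF \<pi>] by linarith
  next
    fix \<epsilon> :: real assume pos: "\<delta> > 0" "\<epsilon> > 0"
    have "\<delta> * measure P (frontier \<Omega> \<times> frontier \<Omega>) \<le> 0"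
      using opt[OF PP] frontier_nonneg[OF PP] by linarith
    then have "measure P (frontier \<Omega> \<times> frontier \<Omega>) = 0"
      using pos(1) by (simp add: mult_le_0_iff measure_le_0_iff)
    then have "measure P (\<Omega> \<times> \<Omega>) \<le> measure \<mu>p \<Omega> + measure \<mu>m \<Omega>"
      using plans_discard_frontier[OF \<Omega>(1) \<mu>p \<mu>m PP C] by (metis diff_zero)
    then have "measure P (\<Omega> \<times> \<Omega>) < M" by (simp add: M_def)
    from dual[OF this pos(2)] obtain N l where
      Nl: "\<And>x y. x \<in> \<Omega> \<Longrightarrow> y \<in> \<Omega> \<Longrightarrow> 0 \<le> C (x, y) + (\<Sum>k<N. l k * h k (x, y))"
      "integral\<^sup>L P C - \<epsilon> \<le> - (\<Sum>k<N. l k * a k)"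
      by auto
    \<comment> \<open>The multipliers are sorted by parity: even ones form the correction in the
      first variable, odd ones that in the second.\<close>
    define u where "u x = (\<Sum>k<N. if even k then l k * w (k div 2) x else 0)" for x
    define v where "v x = (\<Sum>k<N. if even k then 0 else l k * w (k div 2) x)" for x
    have ck: "continuous_on \<Omega> (\<lambda>x. if even k then l k * w (k div 2) x else 0)"
      "continuous_on \<Omega> (\<lambda>x. if even k then 0 else l k * w (k div 2) x)" for k
      by (cases "even k"; auto intro!: continuous_intros cw)+
    have cu: "continuous_on \<Omega> u"
      unfolding u_def by (intro continuous_on_sum ck)
    have cv: "continuous_on \<Omega> v"
      unfolding v_def by (intro continuous_on_sum ck)
    have uv: "(\<Sum>k<N. l k * h k (x, y)) = u x + v y" for x y
      unfolding u_def v_def sum.distrib[symmetric] by (intro sum.cong) (auto simp: h_def)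
    have iu: "integral\<^sup>L \<mu>p u = (\<Sum>k<N. if even k then l k * integral\<^sup>L \<mu>p (w (k div 2)) else 0)"
      unfolding u_def by (subst Bochner_Integration.integral_sum)
        (auto intro!: fbm_integrable[OF \<Omega>(1) \<mu>p(1)] ck sum.cong)
    have iv: "integral\<^sup>L \<mu>m v = (\<Sum>k<N. if even k then 0 else l k * integral\<^sup>L \<mu>m (w (k div 2)))"
      unfolding v_def by (subst Bochner_Integration.integral_sum)
        (auto intro!: fbm_integrable[OF \<Omega>(1) \<mu>m(1)] ck sum.cong)
    have la: "(\<Sum>k<N. l k * a k) = integral\<^sup>L \<mu>p u + integral\<^sup>L \<mu>m v"
      unfolding iu iv sum.distrib[symmetric] by (intro sum.cong) (auto simp: a_def)
    show "\<exists>u v. continuous_on \<Omega> u \<and> continuous_on \<Omega> v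
      \<and> (\<forall>x\<in>frontier \<Omega>. u x = 0 \<and> v x = 0) \<and> (\<forall>x\<in>\<Omega>. \<forall>y\<in>\<Omega>. 0 \<le> C (x, y) + u x + v y)
      \<and> integral\<^sup>L P C - \<epsilon> \<le> - integral\<^sup>L \<mu>p u - integral\<^sup>L \<mu>m v"
    proof (intro exI conjI ballI)
      show "0 \<le> C (x, y) + u x + v y" if "x \<in> \<Omega>" "y \<in> \<Omega>" for x y
        using Nl(1)[OF that] by (simp add: uv)
      show "u x = 0" "v x = 0" if "x \<in> frontier \<Omega>" for x
        using w(2)[OF that] by (auto simp: u_def v_def intro!: sum.neutral)
      show "integral\<^sup>L P C - \<epsilon> \<le> - integral\<^sup>L \<mu>p u - integral\<^sup>L \<mu>m v"
        using Nl(2) by (simp add: la)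
    qed (fact cu cv)+
  qed
qed

section \<open>Duality\<close>

text \<open>A common Lipschitz constant survives the infimum, which gives continuity of
  c-transforms. Boundedness below is required since a real \<open>INF\<close> is meaningful only
  then, and \<open>\<bar>L\<bar>\<close> supplies the nonnegative constant that
  \<open>lipschitz_onI\<close> asks for.\<close>

lemma continuous_on_INF_lipschitz:
  fixes g :: "'b \<Rightarrow> 'a::metric_space \<Rightarrow> real"
  assumes S: "S \<noteq> {}"
    and lip: "\<And>x y y'. x \<in> S \<Longrightarrow> y \<in> T \<Longrightarrow> y' \<in> T \<Longrightarrow> g x y \<le> g x y' + L * dist y y'"
    and bdd: "\<And>y. y \<in> T \<Longrightarrow> bdd_below ((\<lambda>x. g x y) ` S)"
  shows "continuous_on T (\<lambda>y. INF x\<in>S. g x y)"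
proof -
  have le: "(INF x\<in>S. g x y) \<le> (INF x\<in>S. g x y') + \<bar>L\<bar> * dist y y'" if "y \<in> T" "y' \<in> T" for y y'
  proof -
    have "(INF x\<in>S. g x y) - \<bar>L\<bar> * dist y y' \<le> (INF x\<in>S. g x y')"
    proof (rule cINF_greatest[OF S])
      fix x assume x: "x \<in> S"
      have "(INF x\<in>S. g x y) \<le> g x y" by (rule cINF_lower[OF bdd[OF that(1)] x])
      also have "\<dots> \<le> g x y' + L * dist y y'" using lip x that by blast
      also have "L * dist y y' \<le> \<bar>L\<bar> * dist y y'" by (intro mult_right_mono) auto
      finally show "(INF x\<in>S. g x y) - \<bar>L\<bar> * dist y y' \<le> g x y'" by simp
    qed
    then show ?thesis by simp
  qed
  have "\<bar>L\<bar>-lipschitz_on T (\<lambda>y. INF x\<in>S. g x y)"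
  proof (rule lipschitz_onI)
    fix y y' assume "y \<in> T" "y' \<in> T"
    then show "dist (INF x\<in>S. g x y) (INF x\<in>S. g x y') \<le> \<bar>L\<bar> * dist y y'"
      using le[of y y'] le[of y' y] by (simp add: dist_real_def abs_le_iff dist_commute[of y' y])
  qed simp
  then show ?thesis by (rule lipschitz_on_continuous_on)
qed

text \<open>A \<open>\<delta>\<close>-admissible pair is made admissible by truncation with c-transforms;
  the compatibility of the boundary data keeps the boundary values.\<close>

lemma repair_potentials:
  fixes \<Omega> :: "'a::euclidean_space set" and c :: "'a \<times> 'a \<Rightarrow> real"
  assumes \<Omega>: "compact \<Omega>" "frontier \<Omega> \<noteq> {}" and lip: "L-lipschitz_on (\<Omega> \<times> \<Omega>) c"
    and cont: "continuous_on \<Omega> \<phi>p" "continuous_on \<Omega> \<phi>m"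
    and compat: "\<And>x y. x \<in> frontier \<Omega> \<Longrightarrow> y \<in> frontier \<Omega> \<Longrightarrow> \<phi>m y - \<phi>p x \<le> c (x, y)"
    and adm: "\<And>x y. x \<in> \<Omega> \<Longrightarrow> y \<in> \<Omega> \<Longrightarrow> \<phi>m y - \<phi>p x \<le> c (x, y) + \<delta>"
    and \<delta>: "0 \<le> \<delta>"
  obtains fp fm where "continuous_on \<Omega> fp" "continuous_on \<Omega> fm"
    "\<And>x. x \<in> frontier \<Omega> \<Longrightarrow> fp x = \<phi>p x" "\<And>x. x \<in> frontier \<Omega> \<Longrightarrow> fm x = \<phi>m x"
    "\<And>x y. x \<in> \<Omega> \<Longrightarrow> y \<in> \<Omega> \<Longrightarrow> fm y - fp x \<le> c (x, y)"
    "\<And>x. x \<in> \<Omega> \<Longrightarrow> fp x \<le> \<phi>p x + \<delta>" "\<And>x. x \<in> \<Omega> \<Longrightarrow> \<phi>m x - \<delta> \<le> fm x"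
proof -
  have cl: "closed \<Omega>" using \<Omega> compact_imp_closed by blast
  have sub: "frontier \<Omega> \<subseteq> \<Omega>" by (rule frontier_subset_closed[OF cl])
  have ne: "\<Omega> \<noteq> {}" using \<Omega>(2) sub by auto
  have cb: "bounded (c ` (\<Omega> \<times> \<Omega>))"
    using \<Omega> lip by (intro compact_imp_bounded compact_continuous_image compact_Times lipschitz_on_continuous_on)
  then obtain Bc where Bc: "\<And>x y. x \<in> \<Omega> \<Longrightarrow> y \<in> \<Omega> \<Longrightarrow> \<bar>c (x, y)\<bar> \<le> Bc"
    by (auto simp: bounded_iff)
  have "bounded (\<phi>p ` \<Omega>)" "bounded (\<phi>m ` \<Omega>)"
    using \<Omega> cont by (auto intro!: compact_imp_bounded compact_continuous_image)
  then obtain Bp Bm where Bp: "\<And>x. x \<in> \<Omega> \<Longrightarrow> \<bar>\<phi>p x\<bar> \<le> Bp" and Bm: "\<And>x. x \<in> \<Omega> \<Longrightarrow> \<bar>\<phi>m x\<bar> \<le> Bm"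
    by (auto simp: bounded_iff)
  have lip2: "c (x, y) \<le> c (x, y') + L * dist y y'" if "x \<in> \<Omega>" "y \<in> \<Omega>" "y' \<in> \<Omega>" for x y y'
    using lipschitz_onD[OF lip, of "(x, y)" "(x, y')"] that by (auto simp: dist_Pair_Pair dist_real_def)
  have lip1: "c (x, y) \<le> c (x', y) + L * dist x x'" if "x \<in> \<Omega>" "y \<in> \<Omega>" "x' \<in> \<Omega>" for x y x'
    using lipschitz_onD[OF lip, of "(x, y)" "(x', y)"] that by (auto simp: dist_Pair_Pair dist_real_def)
  \<comment> \<open>The infimum runs over boundary points only. Compatibility gives
    \<open>A \<ge> \<phi>m\<close> on the boundary, so capping by \<open>A\<close> changes no
    boundary value; elsewhere it costs at most \<delta>. The cap makes the inequality exact whenever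
    \<open>x\<close> is a boundary point.\<close>
  define A where "A y = (INF x\<in>frontier \<Omega>. \<phi>p x + c (x, y))" for y
  have bA: "bdd_below ((\<lambda>x. \<phi>p x + c (x, y)) ` frontier \<Omega>)" if "y \<in> \<Omega>" for y
  proof (rule bdd_belowI2[where m = "- Bp - Bc"])
    fix x assume "x \<in> frontier \<Omega>"
    then have "x \<in> \<Omega>" using sub by auto
    then show "- Bp - Bc \<le> \<phi>p x + c (x, y)" using Bp[of x] Bc[of x y] that by linarith
  qed
  have cA: "continuous_on \<Omega> A"
    unfolding A_def using bA lip2 sub by (intro continuous_on_INF_lipschitz[OF \<Omega>(2), where L = L]) auto
  have A_le: "A y \<le> \<phi>p x + c (x, y)" if "x \<in> frontier \<Omega>" "y \<in> \<Omega>" for x y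
    unfolding A_def using bA[OF that(2)] that(1) by (rule cINF_lower)
  have A_ge: "\<phi>m y - \<delta> \<le> A y" if "y \<in> \<Omega>" for y
    unfolding A_def
  proof (rule cINF_greatest[OF \<Omega>(2)])
    fix x assume "x \<in> frontier \<Omega>"
    then show "\<phi>m y - \<delta> \<le> \<phi>p x + c (x, y)" using adm[of x y] that sub by auto
  qed
  have A_fr: "\<phi>m y \<le> A y" if "y \<in> frontier \<Omega>" for y
    unfolding A_def
  proof (rule cINF_greatest[OF \<Omega>(2)])
    fix x assume "x \<in> frontier \<Omega>"
    then show "\<phi>m y \<le> \<phi>p x + c (x, y)" using compat[of x y] that by auto
  qed
  define fm where "fm y = min (\<phi>m y) (A y)" for y
  have cfm: "continuous_on \<Omega> fm" unfolding fm_def by (intro continuous_intros cont cA)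
  \<comment> \<open>\<open>- D x\<close> is the least value that the first potential may take at
    \<open>x\<close> against \<open>fm\<close>. On the boundary it is at most
    \<open>\<phi>p x\<close> by the cap \<open>A\<close>, so the maximum defining \<open>fp\<close>
    keeps the boundary value.\<close>
  define D where "D x = (INF y\<in>\<Omega>. c (x, y) - fm y)" for x
  have bD: "bdd_below ((\<lambda>y. c (x, y) - fm y) ` \<Omega>)" if "x \<in> \<Omega>" for x
  proof (rule bdd_belowI2[where m = "- Bm - Bc"])
    fix y assume y: "y \<in> \<Omega>"
    have "fm y \<le> \<phi>m y" by (simp add: fm_def)
    then show "- Bm - Bc \<le> c (x, y) - fm y" using Bm[OF y] Bc[OF that y] by linarith
  qed
  have cD: "continuous_on \<Omega> D"
    unfolding D_def using bD lip1 by (intro continuous_on_INF_lipschitz[OF ne, where L = L]) auto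
  define fp where "fp x = max (\<phi>p x) (- D x)" for x
  show thesis
  proof (rule that[of fp fm])
    show "continuous_on \<Omega> fp" unfolding fp_def by (intro continuous_intros cont cD)
    show "continuous_on \<Omega> fm" by fact
    show "fm x = \<phi>m x" if "x \<in> frontier \<Omega>" for x using A_fr[OF that] by (simp add: fm_def)
    show "fp x = \<phi>p x" if x: "x \<in> frontier \<Omega>" for x
    proof -
      have "- \<phi>p x \<le> D x"
        unfolding D_def
      proof (rule cINF_greatest[OF ne])
        fix y assume "y \<in> \<Omega>"
        then show "- \<phi>p x \<le> c (x, y) - fm y" using A_le[OF x, of y] by (simp add: fm_def)
      qed
      then show ?thesis by (simp add: fp_def)
    qed
    show "fm y - fp x \<le> c (x, y)" if "x \<in> \<Omega>" "y \<in> \<Omega>" for x y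
    proof -
      have "D x \<le> c (x, y) - fm y" unfolding D_def using bD[OF that(1)] that(2) by (rule cINF_lower)
      then show ?thesis by (simp add: fp_def)
    qed
    show "fp x \<le> \<phi>p x + \<delta>" if x: "x \<in> \<Omega>" for x
    proof -
      have "- \<phi>p x - \<delta> \<le> D x"
        unfolding D_def
      proof (rule cINF_greatest[OF ne])
        fix y assume y: "y \<in> \<Omega>"
        have "fm y \<le> \<phi>m y" by (simp add: fm_def)
        then show "- \<phi>p x - \<delta> \<le> c (x, y) - fm y" using adm[OF x y] by linarith
      qed
      then show ?thesis using \<delta> by (simp add: fp_def)
    qed
    show "\<phi>m x - \<delta> \<le> fm x" if "x \<in> \<Omega>" for x using A_ge[OF that] \<delta> by (simp add: fm_def)
  qed
qed

text \<open>Integrating the constraint on the potentials against \<pi> leaves the boundary parts of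
  the marginals, where \<open>\<phi>p \<le> \<psi>p\<close> and \<open>\<psi>m \<le> \<phi>m\<close>
  point in the right direction.\<close>

lemma weak_duality:
  fixes \<Omega> :: "'a::euclidean_space set" and c :: "'a \<times> 'a \<Rightarrow> real"
  assumes \<Omega>: "compact \<Omega>" and c: "continuous_on (\<Omega> \<times> \<Omega>) c"
    and \<mu>p: "\<mu>p \<in> finite_borel_measures \<Omega>" "emeasure \<mu>p (frontier \<Omega>) = 0"
    and \<mu>m: "\<mu>m \<in> finite_borel_measures \<Omega>" "emeasure \<mu>m (frontier \<Omega>) = 0"
    and \<psi>: "continuous_on (frontier \<Omega>) \<psi>p" "continuous_on (frontier \<Omega>) \<psi>m"
    and \<pi>: "\<pi> \<in> plans \<Omega> \<mu>p \<mu>m" and \<phi>: "(\<phi>p, \<phi>m) \<in> potentials \<Omega> c \<psi>p \<psi>m"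
  shows "integral\<^sup>L \<mu>m \<phi>m - integral\<^sup>L \<mu>p \<phi>p \<le> transport_cost \<Omega> c \<psi>p \<psi>m \<pi>"
proof -
  have cl: "closed \<Omega>" using \<Omega> by (rule compact_imp_closed)
  have cK: "compact (\<Omega> \<times> \<Omega>)" using \<Omega> by (intro compact_Times)
  have p: "\<pi> \<in> finite_borel_measures (\<Omega> \<times> \<Omega>)" using \<pi> by (simp add: plans_def)
  have ph: "continuous_on \<Omega> \<phi>p" "continuous_on \<Omega> \<phi>m"
    "\<And>x. x \<in> frontier \<Omega> \<Longrightarrow> \<psi>m x \<le> \<phi>m x" "\<And>x. x \<in> frontier \<Omega> \<Longrightarrow> \<phi>p x \<le> \<psi>p x"
    "\<And>x y. x \<in> \<Omega> \<Longrightarrow> y \<in> \<Omega> \<Longrightarrow> \<phi>m y - \<phi>p x \<le> c (x, y)"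
    using \<phi> by (auto simp: potentials_def)
  \<comment> \<open>The data \<open>\<psi>p\<close>, \<open>\<psi>m\<close> are continuous only on
    the boundary, so integrability is obtained for the measure restricted to this compact
    set.\<close>
  have set_mono: "(LINT x:frontier \<Omega>|\<mu>. f x) \<le> (LINT x:frontier \<Omega>|\<mu>. g x)"
    if \<mu>: "\<mu> \<in> finite_borel_measures \<Omega>" and fg: "continuous_on (frontier \<Omega>) f" "continuous_on (frontier \<Omega>) g"
      "\<And>x. x \<in> frontier \<Omega> \<Longrightarrow> f x \<le> g x" for \<mu> and f g :: "'a \<Rightarrow> real"
  proof -
    interpret finite_measure \<mu> using \<mu> by (rule fbmD)
    have F: "frontier \<Omega> \<in> sets \<mu>"
      using frontier_subset_closed[OF cl] cl fbmD(1)[OF \<mu>] by (auto simp: sets_restrict_space_iff)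
    have r: "restrict_space \<mu> (frontier \<Omega>) \<in> finite_borel_measures (frontier \<Omega>)"
      using sets_restrict_space_cong[OF fbmD(1)[OF \<mu>], of "frontier \<Omega>"] finite_measure_restrict_space[OF fbmD(3)[OF \<mu>] F]
        frontier_subset_closed[OF cl]
      by (simp add: finite_borel_measures_def restrict_restrict_space Int_absorb1 cl borel_closed Int_absorb2)
    have "integral\<^sup>L (restrict_space \<mu> (frontier \<Omega>)) f \<le> integral\<^sup>L (restrict_space \<mu> (frontier \<Omega>)) g"
      using fg fbmD(2)[OF r]
      by (intro integral_mono fbm_integrable[OF compact_frontier[OF \<Omega>] r]) auto
    then show ?thesis
      using F by (simp add: integral_restrict_space set_lebesgue_integral_def)
  qed
  have cont: "continuous_on (\<Omega> \<times> \<Omega>) (\<lambda>z. \<phi>p (fst z))" "continuous_on (\<Omega> \<times> \<Omega>) (\<lambda>z. \<phi>m (snd z))"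
    by (rule continuous_on_compose2[OF ph(1)] continuous_on_compose2[OF ph(2)]; auto intro!: continuous_intros)+
  note int = fbm_integrable[OF cK p cont(1)] fbm_integrable[OF cK p cont(2)] fbm_integrable[OF cK p c]
  have "(LINT z|\<pi>. \<phi>m (snd z)) - (LINT z|\<pi>. \<phi>p (fst z)) = (LINT z|\<pi>. \<phi>m (snd z) - \<phi>p (fst z))"
    using int by simp
  also have "\<dots> \<le> (LINT z|\<pi>. c z)"
    using int ph(5) fbmD(2)[OF p] by (intro integral_mono Bochner_Integration.integrable_diff) auto
  finally have "(LINT z|\<pi>. \<phi>m (snd z)) - (LINT z|\<pi>. \<phi>p (fst z)) \<le> (LINT z|\<pi>. c z)" .
  moreover have "(LINT x:frontier \<Omega>|marginal_x \<Omega> \<pi>. \<phi>p x) \<le> (LINT x:frontier \<Omega>|marginal_x \<Omega> \<pi>. \<psi>p x)"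
    using ph frontier_subset_closed[OF cl]
    by (intro set_mono marginal_fbm p \<psi>) (auto intro: continuous_on_subset)
  moreover have "(LINT x:frontier \<Omega>|marginal_y \<Omega> \<pi>. \<psi>m x) \<le> (LINT x:frontier \<Omega>|marginal_y \<Omega> \<pi>. \<phi>m x)"
    using ph frontier_subset_closed[OF cl]
    by (intro set_mono marginal_fbm p \<psi>) (auto intro: continuous_on_subset)
  ultimately show ?thesis
    using plan_integral(1)[OF \<Omega> \<mu>p \<mu>m \<pi> ph(1)] plan_integral(2)[OF \<Omega> \<mu>p \<mu>m \<pi> ph(2)]
    by (simp add: transport_cost_def)
qed

theorem proposition3p1:
  fixes \<Omega> :: "'a::euclidean_space set"
    and c :: "'a \<times> 'a \<Rightarrow> real"
    and \<mu>p \<mu>m :: "'a measure"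
    and \<psi>p \<psi>m :: "'a \<Rightarrow> real"
  assumes "compact \<Omega>"
    and "\<mu>p \<in> finite_borel_measures \<Omega>" and "emeasure \<mu>p (frontier \<Omega>) = 0"
    and "\<mu>m \<in> finite_borel_measures \<Omega>" and "emeasure \<mu>m (frontier \<Omega>) = 0"
    and "\<exists>L. L-lipschitz_on (\<Omega> \<times> \<Omega>) c"
    and "continuous_on (frontier \<Omega>) \<psi>p" and "continuous_on (frontier \<Omega>) \<psi>m"
    and "\<forall>x\<in>frontier \<Omega>. \<forall>y\<in>frontier \<Omega>. \<psi>m y - \<psi>p x \<le> c (x, y)"
  shows "(\<exists>\<pi>\<in>plans \<Omega> \<mu>p \<mu>m.
            ereal (transport_cost \<Omega> c \<psi>p \<psi>m \<pi>) = primal_value \<Omega> c \<mu>p \<mu>m \<psi>p \<psi>m) \<and>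
         ((\<forall>x\<in>frontier \<Omega>. \<psi>m x \<le> \<psi>p x) \<longrightarrow>
            primal_value \<Omega> c \<mu>p \<mu>m \<psi>p \<psi>m = dual_value \<Omega> c \<mu>p \<mu>m \<psi>p \<psi>m)"
proof -
  note \<Omega> = assms(1) and \<mu>p = assms(2,3) and \<mu>m = assms(4,5) and \<psi> = assms(7,8)
  obtain L where L: "L-lipschitz_on (\<Omega> \<times> \<Omega>) c" using assms(6) by blast
  then have c: "continuous_on (\<Omega> \<times> \<Omega>) c" by (rule lipschitz_on_continuous_on)
  have cl: "closed \<Omega>" using \<Omega> by (rule compact_imp_closed)
  have sub: "frontier \<Omega> \<subseteq> \<Omega>" by (rule frontier_subset_closed[OF cl])
  have cK: "compact (\<Omega> \<times> \<Omega>)" using \<Omega> by (intro compact_Times)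
  interpret \<mu>p: finite_measure \<mu>p using \<mu>p(1) by (rule fbmD)
  interpret \<mu>m: finite_measure \<mu>m using \<mu>m(1) by (rule fbmD)
  have attained: "primal_value \<Omega> c \<mu>p \<mu>m \<psi>p \<psi>m = ereal (transport_cost \<Omega> c \<psi>p \<psi>m P)"
    if "P \<in> plans \<Omega> \<mu>p \<mu>m"
      "\<And>\<pi>. \<pi> \<in> plans \<Omega> \<mu>p \<mu>m \<Longrightarrow> transport_cost \<Omega> c \<psi>p \<psi>m P \<le> transport_cost \<Omega> c \<psi>p \<psi>m \<pi>" for P
    unfolding primal_value_def using that by (intro INF_eqI) auto
  show ?thesis
  \<comment> \<open>An empty \<Omega> offers no boundary point through which to route mass. Both
    values are then 0.\<close>
  proof (cases "\<Omega> = {}")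
    case True
    have plans: "null_measure (restrict_space borel {}) \<in> plans \<Omega> \<mu>p \<mu>m"
    proof -
      have eq: "restrict_space M {} = restrict_space N {}" for M N :: "'a measure"
        by (rule measure_eqI) (auto simp: sets_restrict_space)
      show ?thesis
        using True eq[of "marginal_x {} (null_measure (restrict_space borel {}))" \<mu>p]
          eq[of "marginal_y {} (null_measure (restrict_space borel {}))" \<mu>m]
        by (auto simp: plans_def finite_borel_measures_def intro!: finite_measureI)
    qed
    have zero: "transport_cost \<Omega> c \<psi>p \<psi>m \<pi> = 0" if "\<pi> \<in> plans \<Omega> \<mu>p \<mu>m" for \<pi>
    proof -
      have "\<pi> \<in> finite_borel_measures {}" using that True by (simp add: plans_def)
      then have "space \<pi> = {}" by (rule fbmD)
      then show ?thesis
        using True by (simp add: transport_cost_def Bochner_Integration.integral_empty set_lebesgue_integral_def)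
    qed
    have "(\<lambda>_. 0, \<lambda>_. 0) \<in> potentials \<Omega> c \<psi>p \<psi>m" using True by (simp add: potentials_def)
    moreover have "space \<mu>p = {}" "space \<mu>m = {}"
      using True fbmD(2)[OF \<mu>p(1)] fbmD(2)[OF \<mu>m(1)] by auto
    ultimately have "dual_value \<Omega> c \<mu>p \<mu>m \<psi>p \<psi>m = ereal 0"
      unfolding dual_value_def by (intro SUP_eqI) (auto simp: Bochner_Integration.integral_empty)
    moreover have "primal_value \<Omega> c \<mu>p \<mu>m \<psi>p \<psi>m
        = ereal (transport_cost \<Omega> c \<psi>p \<psi>m (null_measure (restrict_space borel {})))"
      by (rule attained[OF plans]) (simp add: zero plans)
    ultimately show ?thesis using plans zero[OF plans] by metis
  next
    case False
    have fr: "frontier \<Omega> \<noteq> {}"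
      using \<Omega> False not_compact_UNIV frontier_eq_empty[of \<Omega>] by auto
    obtain \<Psi>p where \<Psi>p: "continuous_on UNIV \<Psi>p" "\<And>x. x \<in> frontier \<Omega> \<Longrightarrow> \<Psi>p x = \<psi>p x"
      by (rule Dugundji[of "UNIV :: real set" UNIV "frontier \<Omega>" \<psi>p]) (use \<psi>(1) in auto)
    obtain \<Psi>m where \<Psi>m: "continuous_on UNIV \<Psi>m" "\<And>x. x \<in> frontier \<Omega> \<Longrightarrow> \<Psi>m x = \<psi>m x"
      by (rule Dugundji[of "UNIV :: real set" UNIV "frontier \<Omega>" \<psi>m]) (use \<psi>(2) in auto)
    have c\<Psi>: "continuous_on \<Omega> \<Psi>p" "continuous_on \<Omega> \<Psi>m"
      using \<Psi>p(1) \<Psi>m(1) by (auto intro: continuous_on_subset)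
    define C where "C \<delta> z = c z + \<Psi>p (fst z) - \<Psi>m (snd z) + \<delta>" for \<delta> z
    have c\<Psi>2: "continuous_on (\<Omega> \<times> \<Omega>) (\<lambda>z. \<Psi>p (fst z))" "continuous_on (\<Omega> \<times> \<Omega>) (\<lambda>z. \<Psi>m (snd z))"
      by (rule continuous_on_compose2[OF \<Psi>p(1)] continuous_on_compose2[OF \<Psi>m(1)]; auto intro!: continuous_intros)+
    have cC: "continuous_on (\<Omega> \<times> \<Omega>) (C \<delta>)" for \<delta>
      unfolding C_def by (intro continuous_intros c c\<Psi>2)
    have C_fr: "\<delta> \<le> C \<delta> (x, y)" if "x \<in> frontier \<Omega>" "y \<in> frontier \<Omega>" for \<delta> x y
      using assms(9) that \<Psi>p(2) \<Psi>m(2) by (force simp: C_def)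
    \<comment> \<open>The interior contributions of \<open>\<Psi>p\<close> and
      \<open>\<Psi>m\<close> are the same for all plans, so for \<delta> = 0 minimising the integral
      of \<open>C\<close> and minimising the transport cost are the same problem.\<close>
    define k where "k = integral\<^sup>L \<mu>p \<Psi>p - integral\<^sup>L \<mu>m \<Psi>m"
    have cost: "integral\<^sup>L \<pi> (C \<delta>) = transport_cost \<Omega> c \<psi>p \<psi>m \<pi> + k + \<delta> * measure \<pi> (\<Omega> \<times> \<Omega>)"
      if \<pi>: "\<pi> \<in> plans \<Omega> \<mu>p \<mu>m" for \<pi> \<delta>
    proof -
      have p: "\<pi> \<in> finite_borel_measures (\<Omega> \<times> \<Omega>)" using \<pi> by (simp add: plans_def)
      interpret finite_measure \<pi> using p by (rule fbmD)
      have "integral\<^sup>L \<pi> (C \<delta>) = (LINT z|\<pi>. c z) + (LINT z|\<pi>. \<Psi>p (fst z)) - (LINT z|\<pi>. \<Psi>m (snd z))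
          + \<delta> * measure \<pi> (\<Omega> \<times> \<Omega>)"
        unfolding C_def
        using fbm_integrable[OF cK p c] fbm_integrable[OF cK p c\<Psi>2(1)] fbm_integrable[OF cK p c\<Psi>2(2)] fbmD(2)[OF p]
        by (simp add: mult.commute)
      moreover have "(LINT x:frontier \<Omega>|M. \<Psi>p x) = (LINT x:frontier \<Omega>|M. \<psi>p x)"
        "(LINT x:frontier \<Omega>|M. \<Psi>m x) = (LINT x:frontier \<Omega>|M. \<psi>m x)" for M
        unfolding set_lebesgue_integral_def using \<Psi>p(2) \<Psi>m(2)
        by (auto intro!: Bochner_Integration.integral_cong simp: indicator_def)
      ultimately show ?thesis
        by (simp add: plan_integral(1)[OF \<Omega> \<mu>p \<mu>m \<pi> c\<Psi>(1)] plan_integral(2)[OF \<Omega> \<mu>p \<mu>m \<pi> c\<Psi>(2)]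
            transport_cost_def k_def)
    qed
    have core: "\<exists>P\<in>plans \<Omega> \<mu>p \<mu>m. (\<forall>\<pi>\<in>plans \<Omega> \<mu>p \<mu>m. integral\<^sup>L P (C \<delta>) \<le> integral\<^sup>L \<pi> (C \<delta>))
      \<and> (\<forall>\<epsilon>>0. \<delta> > 0 \<longrightarrow> (\<exists>u v. continuous_on \<Omega> u \<and> continuous_on \<Omega> v
        \<and> (\<forall>x\<in>frontier \<Omega>. u x = 0 \<and> v x = 0) \<and> (\<forall>x\<in>\<Omega>. \<forall>y\<in>\<Omega>. 0 \<le> C \<delta> (x, y) + u x + v y)
        \<and> integral\<^sup>L P (C \<delta>) - \<epsilon> \<le> - integral\<^sup>L \<mu>p u - integral\<^sup>L \<mu>m v))" if "0 \<le> \<delta>" for \<delta>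
    proof (rule plans_minimum_and_duality[OF \<Omega> False \<mu>p \<mu>m cC that])
      show "\<delta> \<le> C \<delta> (x, y)" if "x \<in> frontier \<Omega>" "y \<in> frontier \<Omega>" for x y
        by (rule C_fr[OF that])
    qed (intro bexI conjI ballI allI impI; assumption?; blast?)
    \<comment> \<open>Attainment uses \<delta> = 0, where boundary pairs are merely not profitable;
      only the multipliers call for \<delta> > 0.\<close>
    obtain P where P: "P \<in> plans \<Omega> \<mu>p \<mu>m"
      "\<And>\<pi>. \<pi> \<in> plans \<Omega> \<mu>p \<mu>m \<Longrightarrow> integral\<^sup>L P (C 0) \<le> integral\<^sup>L \<pi> (C 0)"
      using core[OF order_refl] by blast
    have minP: "transport_cost \<Omega> c \<psi>p \<psi>m P \<le> transport_cost \<Omega> c \<psi>p \<psi>m \<pi>" if "\<pi> \<in> plans \<Omega> \<mu>p \<mu>m" for \<pi>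
      using P(2)[OF that] cost[OF that, of 0] cost[OF P(1), of 0] by simp
    have primal: "primal_value \<Omega> c \<mu>p \<mu>m \<psi>p \<psi>m = ereal (transport_cost \<Omega> c \<psi>p \<psi>m P)"
      by (rule attained[OF P(1) minP])
    have "primal_value \<Omega> c \<mu>p \<mu>m \<psi>p \<psi>m = dual_value \<Omega> c \<mu>p \<mu>m \<psi>p \<psi>m"
      if \<psi>le: "\<forall>x\<in>frontier \<Omega>. \<psi>m x \<le> \<psi>p x"
    proof (rule antisym)
      show "dual_value \<Omega> c \<mu>p \<mu>m \<psi>p \<psi>m \<le> primal_value \<Omega> c \<mu>p \<mu>m \<psi>p \<psi>m"
        unfolding dual_value_def primal
        using weak_duality[OF \<Omega> c \<mu>p \<mu>m \<psi> P(1)] by (auto intro!: SUP_least)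
      \<comment> \<open>The total loss is \<delta> times \<open>Q\<close>: truncation costs \<delta>
        times the mass of \<open>\<mu>p\<close> and of \<open>\<mu>m\<close>, and the duality gap
        accepted below is one more \<delta>.\<close>
      define Q where "Q = measure \<mu>p \<Omega> + measure \<mu>m \<Omega> + 1"
      have Q: "Q > 0" by (simp add: Q_def add_nonneg_pos)
      have approx: "ereal (transport_cost \<Omega> c \<psi>p \<psi>m P) \<le> dual_value \<Omega> c \<mu>p \<mu>m \<psi>p \<psi>m + ereal \<epsilon>"
        if "\<epsilon> > 0" for \<epsilon>
      proof -
        define \<delta> where "\<delta> = \<epsilon> / Q"
        have \<delta>: "\<delta> > 0" "\<delta> * Q = \<epsilon>" using that Q by (auto simp: \<delta>_def)
        obtain R u v where R: "R \<in> plans \<Omega> \<mu>p \<mu>m" and u: "continuous_on \<Omega> u" and v: "continuous_on \<Omega> v"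
          and uv: "\<forall>x\<in>frontier \<Omega>. u x = 0 \<and> v x = 0"
            "\<forall>x\<in>\<Omega>. \<forall>y\<in>\<Omega>. 0 \<le> C \<delta> (x, y) + u x + v y"
            "integral\<^sup>L R (C \<delta>) - \<delta> \<le> - integral\<^sup>L \<mu>p u - integral\<^sup>L \<mu>m v"
          using core[OF less_imp_le[OF \<delta>(1)]] \<delta>(1) by blast
        \<comment> \<open>With these signs, nonnegativity of
          \<open>C \<delta> (x, y) + u x + v y\<close> reads as admissibility up to
          \<delta>.\<close>
        define \<phi>p where "\<phi>p x = \<Psi>p x + u x" for x
        define \<phi>m where "\<phi>m y = \<Psi>m y - v y" for y
        have c\<phi>: "continuous_on \<Omega> \<phi>p" "continuous_on \<Omega> \<phi>m"
          unfolding \<phi>p_def \<phi>m_def by (intro continuous_intros c\<Psi> u v)+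
        have \<phi>fr: "\<phi>p x = \<psi>p x" "\<phi>m x = \<psi>m x" if "x \<in> frontier \<Omega>" for x
          using bspec[OF uv(1) that] \<Psi>p(2)[OF that] \<Psi>m(2)[OF that] by (auto simp: \<phi>p_def \<phi>m_def)
        have compat: "\<phi>m y - \<phi>p x \<le> c (x, y)" if "x \<in> frontier \<Omega>" "y \<in> frontier \<Omega>" for x y
          using assms(9) \<phi>fr that by auto
        have adm: "\<phi>m y - \<phi>p x \<le> c (x, y) + \<delta>" if "x \<in> \<Omega>" "y \<in> \<Omega>" for x y
          using uv(2) that by (fastforce simp: C_def \<phi>p_def \<phi>m_def)
        obtain fp fm where f: "continuous_on \<Omega> fp" "continuous_on \<Omega> fm"
          "\<And>x. x \<in> frontier \<Omega> \<Longrightarrow> fp x = \<phi>p x" "\<And>x. x \<in> frontier \<Omega> \<Longrightarrow> fm x = \<phi>m x"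
          "\<And>x y. x \<in> \<Omega> \<Longrightarrow> y \<in> \<Omega> \<Longrightarrow> fm y - fp x \<le> c (x, y)"
          "\<And>x. x \<in> \<Omega> \<Longrightarrow> fp x \<le> \<phi>p x + \<delta>" "\<And>x. x \<in> \<Omega> \<Longrightarrow> \<phi>m x - \<delta> \<le> fm x"
        proof (rule repair_potentials[OF \<Omega> fr L c\<phi>])
          show "\<phi>m y - \<phi>p x \<le> c (x, y)" if "x \<in> frontier \<Omega>" "y \<in> frontier \<Omega>" for x y
            by (rule compat[OF that])
          show "\<phi>m y - \<phi>p x \<le> c (x, y) + \<delta>" if "x \<in> \<Omega>" "y \<in> \<Omega>" for x y
            by (rule adm[OF that])
          show "0 \<le> \<delta>" using \<delta>(1) by simp
        qed (erule that, assumption, blast+)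
        \<comment> \<open>On the boundary \<open>fp\<close> and \<open>fm\<close> equal
          \<open>\<psi>p\<close> and \<open>\<psi>m\<close>, so the required chain of inequalities
          there reduces to \<open>\<psi>le\<close>.\<close>
        have pot: "(fp, fm) \<in> potentials \<Omega> c \<psi>p \<psi>m"
          using f \<phi>fr \<psi>le by (auto simp: potentials_def)
        have "integral\<^sup>L \<mu>p fp \<le> (LINT x|\<mu>p. \<phi>p x + \<delta>)"
          using f(6) fbmD(2)[OF \<mu>p(1)] fbm_integrable[OF \<Omega> \<mu>p(1) f(1)] fbm_integrable[OF \<Omega> \<mu>p(1) c\<phi>(1)]
          by (intro integral_mono) auto
        also have "\<dots> = integral\<^sup>L \<mu>p \<phi>p + \<delta> * measure \<mu>p \<Omega>"
          using fbmD(2)[OF \<mu>p(1)] fbm_integrable[OF \<Omega> \<mu>p(1) c\<phi>(1)] by (simp add: mult.commute)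
        also have "integral\<^sup>L \<mu>p \<phi>p = integral\<^sup>L \<mu>p \<Psi>p + integral\<^sup>L \<mu>p u"
          unfolding \<phi>p_def using fbm_integrable[OF \<Omega> \<mu>p(1) c\<Psi>(1)] fbm_integrable[OF \<Omega> \<mu>p(1) u] by simp
        finally have ip: "integral\<^sup>L \<mu>p fp \<le> integral\<^sup>L \<mu>p \<Psi>p + integral\<^sup>L \<mu>p u + \<delta> * measure \<mu>p \<Omega>" .
        have "integral\<^sup>L \<mu>m \<phi>m - \<delta> * measure \<mu>m \<Omega> = (LINT x|\<mu>m. \<phi>m x - \<delta>)"
          using fbmD(2)[OF \<mu>m(1)] fbm_integrable[OF \<Omega> \<mu>m(1) c\<phi>(2)] by (simp add: mult.commute)
        also have "\<dots> \<le> integral\<^sup>L \<mu>m fm"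
          using f(7) fbmD(2)[OF \<mu>m(1)] fbm_integrable[OF \<Omega> \<mu>m(1) f(2)] fbm_integrable[OF \<Omega> \<mu>m(1) c\<phi>(2)]
          by (intro integral_mono) auto
        finally have im: "integral\<^sup>L \<mu>m \<Psi>m - integral\<^sup>L \<mu>m v - \<delta> * measure \<mu>m \<Omega> \<le> integral\<^sup>L \<mu>m fm"
          unfolding \<phi>m_def using fbm_integrable[OF \<Omega> \<mu>m(1) c\<Psi>(2)] fbm_integrable[OF \<Omega> \<mu>m(1) v] by simp
        \<comment> \<open>\<open>R\<close> is optimal for the shifted cost and \<open>P\<close> for
          the original one. The shift only adds the nonnegative term \<delta> times the mass of
          \<open>R\<close>, so no estimate of that mass is called for.\<close>
        have "transport_cost \<Omega> c \<psi>p \<psi>m P + k \<le> integral\<^sup>L R (C \<delta>)"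
        proof -
          have "0 \<le> \<delta> * measure R (\<Omega> \<times> \<Omega>)" using \<delta>(1) by simp
          then show ?thesis using minP[OF R] cost[OF R, of \<delta>] by linarith
        qed
        moreover have "\<delta> * measure \<mu>p \<Omega> + \<delta> * measure \<mu>m \<Omega> + \<delta> = \<epsilon>"
          using \<delta>(2) by (simp add: Q_def algebra_simps)
        ultimately have "transport_cost \<Omega> c \<psi>p \<psi>m P \<le> integral\<^sup>L \<mu>m fm - integral\<^sup>L \<mu>p fp + \<epsilon>"
          using ip im uv(3) unfolding k_def by linarith
        then have "ereal (transport_cost \<Omega> c \<psi>p \<psi>m P) \<le> ereal (integral\<^sup>L \<mu>m fm - integral\<^sup>L \<mu>p fp) + ereal \<epsilon>"
          by simp
        also have "\<dots> \<le> dual_value \<Omega> c \<mu>p \<mu>m \<psi>p \<psi>m + ereal \<epsilon>"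
        proof (rule add_right_mono)
          show "ereal (integral\<^sup>L \<mu>m fm - integral\<^sup>L \<mu>p fp) \<le> dual_value \<Omega> c \<mu>p \<mu>m \<psi>p \<psi>m"
            unfolding dual_value_def by (rule SUP_upper2[OF pot]) simp
        qed
        finally show ?thesis .
      qed
      show "primal_value \<Omega> c \<mu>p \<mu>m \<psi>p \<psi>m \<le> dual_value \<Omega> c \<mu>p \<mu>m \<psi>p \<psi>m"
        unfolding primal by (rule ereal_le_epsilon2) (rule approx)
    qed
    then show ?thesis using P(1) primal[symmetric] by blast
  qed
qed

end
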